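(* Let $f: A\to A$ be a non-wandering twist map on the closed annulus $A=\mathbb{T}\times[0,1]$. If $C_1$ and $C_2$ are two disjoint invariant curves of $f$, then the rotation numbers of $f$ on $C_1$ and on $C_2$, computed with respect to a common lift of $f$, are different.
   Context: Let $\mathbb{T}=\mathbb{R}/\mathbb{Z}$, $A=\mathbb{T}\times[0,1]$ the closed annulus, $\tilde A=\mathbb{R}\times[0,1]$ its universal cover, and $\pi_1$ the projection to the first coordinate (from $A$ to $\mathbb{T}$, or from $\tilde A$ to $\mathbb{R}$). Twist map: an orientation-preserving homeomorphism $f:A\to A$, $(x,y)\mapsto(x_1,y_1)$, that preserves each boundary component ($y_1=0$ if $y=0$, and $y_1=1$ if $y=1$) and satisfies the (positive) twist condition: for each $x$, the map $y\mapsto x_1(x,y)$ is strictly increasing on $[0,1]$. The monotonicity is understood on the universal cover: for a lift $\tilde f:\tilde A\to\tilde A$ of $f$ and each $\tilde x\in\mathbb{R}$, the real-valued function $y\mapsto\pi_1(\tilde f(\tilde x,y))$ is strictly increasing. Non-wandering: a point $z\in A$ is wandering if it has an open neighborhood $U$ with $f^n(U)\cap U=\emptyset$ for every $n\ge1$; $f$ is non-wandering if no point of $A$ is wandering. Invariant curve: an $f$-invariant circle $C\subset A$ (a simple closed curve with $f(C)=C$) that goes around the annulus, i.e. is not null-homotopic in $A$. Rotation number on an invariant curve: fix one lift $\tilde f:\tilde A\to\tilde A$ of $f$ (lifts are unique up to integer translations $(x,y)\mapsto(x+k,y)$, $k\in\mathbb{Z}$). The rotation number of $f$ on an invariant curve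 $C$ is $\lim_{n\to\infty}\frac{\pi_1(\tilde f^n(\tilde z))-\pi_1(\tilde z)}{n}\in\mathbb{R}$, where $\tilde z\in\tilde A$ is any lift of a point of $C$; the limit exists and does not depend on $\tilde z$. The same lift is used for all invariant curves. *)

theory Defs
  imports "HOL-Complex_Analysis.Complex_Analysis"
begin

(* The circle R/Z is realised as the unit circle in the complex plane, with the class
   of x corresponding to cis (2 * pi * x).  A map of the annulus is a function on the
   ambient type whose values outside the annulus are irrelevant. *)

definition annulus :: "(complex \<times> real) set" where
  "annulus = sphere 0 1 \<times> {0..1}"

definition strip :: "(real \<times> real) set" where
  "strip = UNIV \<times> {0..1}"

definition annulus_cover :: "real \<times> real \<Rightarrow> complex \<times> real" where
  "annulus_cover z = (cis (2 * pi * fst z), snd z)"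

definition is_lift :: "(real \<times> real \<Rightarrow> real \<times> real) \<Rightarrow> (complex \<times> real \<Rightarrow> complex \<times> real) \<Rightarrow> bool" where
  "is_lift F f \<longleftrightarrow>
     continuous_on strip F \<and> F ` strip \<subseteq> strip \<and>
     (\<forall>z\<in>strip. annulus_cover (F z) = f (annulus_cover z))"

(* A continuous self-map of the annulus always has lifts, and any two differ by an
   integer translation; hence "for every lift" below means the same as "for some lift". *)

(* For a homeomorphism f: the local degree at every interior point is +1.  It is computed
   in the coordinates provided by the covering map, as the winding number about F (x, y)
   of the image under F of a positively oriented circle around (x, y). *)
definition orientation_preserving :: "(complex \<times> real \<Rightarrow> complex \<times> real) \<Rightarrow> bool" where
  "orientation_preserving f \<longleftrightarrow>
     (\<forall>F. is_lift F f \<longrightarrow>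
       (\<forall>x y r. 0 < r \<and> r < y \<and> y + r < 1 \<longrightarrow>
          (let c = (\<lambda>p. Complex (fst p) (snd p))
           in winding_number
                (\<lambda>t. c (F (x + r * cos (2 * pi * t), y + r * sin (2 * pi * t))))
                (c (F (x, y))) = 1)))"

definition twist_condition :: "(complex \<times> real \<Rightarrow> complex \<times> real) \<Rightarrow> bool" where
  "twist_condition f \<longleftrightarrow>
     (\<forall>F. is_lift F f \<longrightarrow> (\<forall>x. strict_mono_on {0..1} (\<lambda>y. fst (F (x, y)))))"

definition twist_map :: "(complex \<times> real \<Rightarrow> complex \<times> real) \<Rightarrow> bool" where
  "twist_map f \<longleftrightarrow>
     (\<exists>g. homeomorphism annulus annulus f g) \<and>
     orientation_preserving f \<and>
     (\<forall>z\<in>annulus. (snd z = 0 \<longrightarrow> snd (f z) = 0) \<and> (snd z = 1 \<longrightarrow> snd (f z) = 1)) \<and>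
     twist_condition f"

definition wandering :: "(complex \<times> real \<Rightarrow> complex \<times> real) \<Rightarrow> complex \<times> real \<Rightarrow> bool" where
  "wandering f z \<longleftrightarrow>
     (\<exists>U. openin (top_of_set annulus) U \<and> z \<in> U \<and> (\<forall>n\<ge>1. (f ^^ n) ` U \<inter> U = {}))"

definition non_wandering :: "(complex \<times> real \<Rightarrow> complex \<times> real) \<Rightarrow> bool" where
  "non_wandering f \<longleftrightarrow> (\<forall>z\<in>annulus. \<not> wandering f z)"

definition invariant_curve ::
  "(complex \<times> real \<Rightarrow> complex \<times> real) \<Rightarrow> (complex \<times> real) set \<Rightarrow> bool" where
  "invariant_curve f C \<longleftrightarrow>
     f ` C = C \<and>
     (\<exists>\<gamma>. simple_path \<gamma> \<and> pathfinish \<gamma> = pathstart \<gamma> \<and>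
          path_image \<gamma> = C \<and> C \<subseteq> annulus \<and>
          \<not> (\<exists>a. homotopic_loops annulus \<gamma> (linepath a a)))"

definition has_rotation_number ::
  "(real \<times> real \<Rightarrow> real \<times> real) \<Rightarrow> (complex \<times> real) set \<Rightarrow> real \<Rightarrow> bool" where
  "has_rotation_number F C \<rho> \<longleftrightarrow>
     (\<forall>z\<in>strip. annulus_cover z \<in> C \<longrightarrow>
        (\<lambda>n. (fst ((F ^^ n) z) - fst z) / real n) \<longlonglongrightarrow> \<rho>)"

(* Meaningful when F is a lift of a twist map and C is an invariant curve of that map:
   then the limit exists and does not depend on the point z. *)
definition rotation_number ::
  "(real \<times> real \<Rightarrow> real \<times> real) \<Rightarrow> (complex \<times> real) set \<Rightarrow> real" where
  "rotation_number F C = (THE \<rho>. has_rotation_number F C \<rho>)"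

end

theory Submission
  imports Defs "HOL-Homology.Invariance_of_Domain"
begin

text \<open>
  The heart of the matter is Birkhoff's theorem for non-wandering twist maps: every essential
  invariant curve is the graph of a continuous function over the circle
  (\<open>invariant_curve_is_graph\<close>). Two disjoint invariant curves are therefore graphs
  \<open>\<phi> < \<psi>\<close>, and by the twist the circle homeomorphism induced on the upper graph has a lift
  that is strictly larger at every point than the one induced on the lower graph. Such a pair of
  lifts can share only a rational rotation number \<open>m / q\<close> (\<open>equal_rotation_rational\<close>).
  In that case both graphs carry points that \<open>F ^^ q\<close> moves by exactly \<open>m\<close>; let them lie over
  \<open>a\<close> on the lower and over \<open>b\<close> on the upper graph, \<open>a < b < a + 1\<close>. The twist pushes the vertical
  side over \<open>a\<close> of the band between the graphs to the right and the one over \<open>b\<close> to the left, so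
  \<open>F ^^ q\<close> followed by the translation by \<open>- m\<close> maps the part of the band over \<open>[a, b]\<close> into
  itself and misses the inner points of the side over \<open>a\<close>. Points of the band close to this side
  are then wandering for the \<open>q\<close>-th iterate, which is impossible, as iterates of a non-wandering
  map are non-wandering (\<open>rotation_different\<close>).

  For Birkhoff's theorem, extend the lift to a homeomorphism of the plane. Let \<open>K\<close> be the lifted
  curve and \<open>below\<close> the set of points that have no point of \<open>K\<close> at or under them on their vertical
  line. The decisive fact is that an orbit segment with both ends in \<open>below\<close> stays in \<open>below\<close>
  (\<open>below_between\<close>). To see it, follow the direction from the \<open>i\<close>-th image of a point \<open>c\<close> of \<open>K\<close>
  to the \<open>i\<close>-th image of \<open>u\<close> while \<open>c\<close> travels along \<open>K\<close> to the far right, where the direction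
  is leftwards for each \<open>i\<close>; this normalises a real-valued angle. A twist map turns vertical
  vectors clockwise, so no angle gets past a vertical direction anticlockwise from one iterate to
  the next (\<open>lags\<close>). If \<open>u\<close> is in \<open>below\<close>, the angle is less than \<open>\<pi> / 2\<close> at time \<open>0\<close> and hence at
  all later times; if the last point is in \<open>below\<close>, the angle exceeds \<open>- 3 \<pi> / 2\<close> at the end and
  hence at all earlier times. Between these bounds no image of \<open>u\<close> lies directly over a point
  of \<open>K\<close>.

  Now suppose that \<open>F ` below\<close> contained an open set disjoint from \<open>below\<close>. Some orbit returns to
  it, which yields a point outside \<open>below\<close> between two points of its orbit inside \<open>below\<close>. So
  \<open>below\<close> is invariant (\<open>below_invariant\<close>). Its upper boundary has no jumps, because a jump would
  be a vertical segment along which \<open>F\<close> or its inverse reverses the order of \<open>K\<close> and \<open>below\<close>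
  (\<open>height_gate\<close>). It is thus an invariant graph contained in \<open>K\<close>, and it projects to a simple
  closed curve inside the given one, that is, to the given one.
\<close>

section \<open>Lifts of circle homeomorphisms\<close>

lemma nonzero_constant_sign:
  fixes h :: "real \<Rightarrow> real"
  assumes h: "continuous_on UNIV h" and nz: "\<And>x. h x \<noteq> 0"
  shows "(\<forall>x. h x > 0) \<or> (\<forall>x. h x < 0)"
proof (rule ccontr)
  assume "\<not> ?thesis"
  then obtain a b where "h a < 0" "h b > 0" using nz by (metis linorder_neqE)
  moreover have "connected (range h)" by (intro connected_continuous_image h connected_UNIV)
  ultimately have "0 \<in> range h" by (meson connectedD_interval less_imp_le rangeI)
  then show False using nz by (metis imageE)
qed

lemma periodic_int:
  fixes h :: "real \<Rightarrow> 'a"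
  assumes per: "\<And>x. h (x + 1) = h x"
  shows "h (x + real_of_int k) = h x"
proof -
  have nat: "h (x + real n) = h x" for x n
  proof (induction n)
    case (Suc n)
    have "h (x + real (Suc n)) = h ((x + real n) + 1)" by (simp add: algebra_simps)
    then show ?case using per Suc by simp
  qed simp
  show ?thesis
  proof (cases "k \<ge> 0")
    case True
    then show ?thesis using nat[of x "nat k"] by simp
  next
    case False
    then show ?thesis using nat[of "x + real_of_int k" "nat (- k)"] by simp
  qed
qed

lemma periodic_positive_bound:
  fixes h :: "real \<Rightarrow> real"
  assumes h: "continuous_on UNIV h" and per: "\<And>x. h (x + 1) = h x" and pos: "\<And>x. h x > 0"
  obtains \<delta> where "\<delta> > 0" "\<And>x. \<delta> \<le> h x"
proof -
  have "\<exists>x\<in>{0..1}. \<forall>y\<in>{0..1}. h x \<le> h y"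
    by (intro continuous_attains_inf continuous_on_subset[OF h]) auto
  then obtain x where x: "\<And>y. y \<in> {0..1} \<Longrightarrow> h x \<le> h y" by blast
  have "h x \<le> h y" for y
  proof -
    have "h (frac y) = h y" using periodic_int[of h y "- \<lfloor>y\<rfloor>", OF per] by (simp add: frac_def)
    moreover have "frac y \<in> {0..1}" by (simp add: frac_lt_1 less_imp_le)
    ultimately show ?thesis using x by metis
  qed
  then show ?thesis using pos that by blast
qed

lemma degree_one_surj:
  fixes h :: "real \<Rightarrow> real"
  assumes h: "continuous_on UNIV h" and shift: "\<And>x. h (x + 1) = h x + 1"
  shows "\<exists>x. h x = s"
proof -
  define k where "k = \<lfloor>s - h 0\<rfloor>"
  have "h (0 + real_of_int j) - (0 + real_of_int j) = h 0 - 0" for j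
    using periodic_int[of "\<lambda>x. h x - x" 0 j] shift by simp
  then have h_int: "h (real_of_int j) = h 0 + real_of_int j" for j by (simp add: algebra_simps)
  have "h (real_of_int k) \<le> s" "s \<le> h (real_of_int (k + 1))"
    unfolding h_int k_def by linarith+
  then have "\<exists>x\<ge>real_of_int k. x \<le> real_of_int (k + 1) \<and> h x = s"
    by (intro IVT' continuous_on_subset[OF h]) auto
  then show ?thesis by blast
qed

locale circle_lift =
  fixes g :: "real \<Rightarrow> real"
  assumes cont: "continuous_on UNIV g" and smono: "strict_mono g" and degree_one: "g (x + 1) = g x + 1"
begin

lemma iter_shift: "(g ^^ n) (x + real_of_int k) = (g ^^ n) x + real_of_int k"
proof -
  have "(g ^^ n) (x + 1) = (g ^^ n) x + 1" for x by (induction n) (auto simp: degree_one)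
  then show ?thesis using periodic_int[of "\<lambda>x. (g ^^ n) x - x" x k] by simp
qed

lemma iter_cont: "continuous_on A (g ^^ n)"
proof (induction n)
  case (Suc n)
  have "continuous_on A (g \<circ> (g ^^ n))"
    by (rule continuous_on_compose[OF Suc continuous_on_subset[OF cont]]) simp
  then show ?case by simp
qed (simp add: id_def)

lemma iter_mono: "x \<le> y \<Longrightarrow> (g ^^ n) x \<le> (g ^^ n) y"
  by (induction n) (auto simp: smono strict_mono_less_eq)

lemma iter_displacement: "\<bar>((g ^^ n) x - x) - (g ^^ n) 0\<bar> \<le> 1"
proof -
  have "(g ^^ n) (0 + real_of_int \<lfloor>x\<rfloor>) \<le> (g ^^ n) x" "(g ^^ n) x \<le> (g ^^ n) (0 + real_of_int (\<lfloor>x\<rfloor> + 1))"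
    by (intro iter_mono; linarith)+
  then show ?thesis unfolding iter_shift by linarith
qed

lemma iter_multiple: "\<bar>(g ^^ (n * k)) 0 - real k * (g ^^ n) 0\<bar> \<le> real k"
proof (induction k)
  case (Suc k)
  have "(g ^^ (n * Suc k)) 0 = (g ^^ n) ((g ^^ (n * k)) 0)" by (simp add: funpow_add)
  then show ?case using Suc iter_displacement[of n "(g ^^ (n * k)) 0"] by (simp add: algebra_simps)
qed simp

text \<open>
  Up to an error of \<open>1\<close> the displacement of \<open>g ^^ n\<close> does not depend on the starting point,
  so the displacements of \<open>0\<close> are additive in \<open>n\<close> up to an error of \<open>1\<close> per summand. Comparing the
  iterate \<open>n * m\<close> with both \<open>n\<close> and \<open>m\<close> makes the averages a Cauchy sequence.
\<close>

lemma rotation_exists: "\<exists>\<rho>. \<forall>x. (\<lambda>n. ((g ^^ n) x - x) / real n) \<longlonglongrightarrow> \<rho>"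
proof -
  define a where "a n = (g ^^ n) 0 / real n" for n
  have dist: "\<bar>a n - a m\<bar> \<le> 1 / real n + 1 / real m" if "n \<ge> 1" "m \<ge> 1" for n m
  proof -
    have *: "\<bar>(g ^^ (n * m)) 0 / (real n * real m) - a n\<bar> \<le> 1 / real n" if "n \<ge> 1" "m \<ge> 1" for n m
    proof -
      have "(g ^^ (n * m)) 0 / (real n * real m) - a n = ((g ^^ (n * m)) 0 - real m * (g ^^ n) 0) / (real n * real m)"
        using that by (simp add: a_def field_simps)
      also have "\<bar>\<dots>\<bar> = \<bar>(g ^^ (n * m)) 0 - real m * (g ^^ n) 0\<bar> / (real n * real m)" by simp
      also have "\<dots> \<le> real m / (real n * real m)"
        by (rule divide_right_mono[OF iter_multiple]) simp
      finally show ?thesis using that by simp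
    qed
    show ?thesis using *[of n m] *[of m n] that by (simp add: mult.commute)
  qed
  have "Cauchy a"
  proof (rule metric_CauchyI)
    fix e :: real assume e: "0 < e"
    obtain M :: nat where M: "2 / e < real M" using reals_Archimedean2 by blast
    then have "M > 0" using e by (metis divide_pos_pos less_trans of_nat_0_less_iff zero_less_numeral)
    have "dist (a m) (a n) < e" if "m \<ge> M" "n \<ge> M" for m n
    proof -
      have k: "1 / real k < e / 2" if "k \<ge> M" for k
      proof -
        have "2 / e < real k" using M that by (metis le_less_trans less_le_trans of_nat_le_iff)
        then show ?thesis using e \<open>M > 0\<close> that by (simp add: field_simps)
      qed
      have "\<bar>a m - a n\<bar> \<le> 1 / real m + 1 / real n" using dist[of m n] that \<open>M > 0\<close> by simp
      then show ?thesis using k[OF that(1)] k[OF that(2)] by (simp add: dist_real_def)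
    qed
    then show "\<exists>M. \<forall>m\<ge>M. \<forall>n\<ge>M. dist (a m) (a n) < e" by blast
  qed
  then obtain \<rho> where \<rho>: "a \<longlonglongrightarrow> \<rho>" by (auto simp: Cauchy_convergent_iff convergent_def)
  have "(\<lambda>n. ((g ^^ n) x - x) / real n) \<longlonglongrightarrow> \<rho>" for x
  proof -
    have "(\<lambda>n. ((g ^^ n) x - x) / real n - a n) \<longlonglongrightarrow> 0"
    proof (rule tendsto_rabs_zero_cancel, rule tendsto_sandwich[OF _ _ tendsto_const lim_inverse_n'])
      show "\<forall>\<^sub>F n in sequentially. \<bar>((g ^^ n) x - x) / real n - a n\<bar> \<le> 1 / real n"
      proof (intro always_eventually allI)
        fix n
        have "((g ^^ n) x - x) / real n - a n = (((g ^^ n) x - x) - (g ^^ n) 0) / real n"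
          by (simp add: a_def diff_divide_distrib)
        then show "\<bar>((g ^^ n) x - x) / real n - a n\<bar> \<le> 1 / real n"
          using iter_displacement[of n x] by (simp add: divide_right_mono)
      qed
    qed simp
    from tendsto_add[OF this \<rho>] show ?thesis by simp
  qed
  then show ?thesis by blast
qed

definition rotation :: real where
  "rotation = (SOME \<rho>. \<forall>x. (\<lambda>n. ((g ^^ n) x - x) / real n) \<longlonglongrightarrow> \<rho>)"

lemma rotation: "(\<lambda>n. ((g ^^ n) x - x) / real n) \<longlonglongrightarrow> rotation"
  using someI_ex[OF rotation_exists] unfolding rotation_def by blast

lemma rotation_subseq:
  assumes "n \<ge> 1"
  shows "(\<lambda>k. ((g ^^ (n * k)) x - x) / (real n * real k)) \<longlonglongrightarrow> rotation"
proof -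
  have "strict_mono (\<lambda>k. n * k)" using assms by (auto simp: strict_mono_def)
  from LIMSEQ_subseq_LIMSEQ[OF rotation this] show ?thesis by (simp add: o_def)
qed

lemma rotation_le_if:
  assumes n: "n \<ge> 1" and k: "\<And>k. (g ^^ (n * k)) x \<le> x + real k * c"
  shows "rotation \<le> c / real n"
proof (rule LIMSEQ_le_const2[OF rotation_subseq[OF n]], intro exI allI impI)
  fix k :: nat assume "1 \<le> k"
  then show "((g ^^ (n * k)) x - x) / (real n * real k) \<le> c / real n"
    using divide_right_mono[of "(g ^^ (n * k)) x - x" "real k * c" "real n * real k"] k[of k] n by simp
qed

lemma rotation_ge_if:
  assumes n: "n \<ge> 1" and k: "\<And>k. x + real k * c \<le> (g ^^ (n * k)) x"
  shows "c / real n \<le> rotation"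
proof (rule LIMSEQ_le_const[OF rotation_subseq[OF n]], intro exI allI impI)
  fix k :: nat assume "1 \<le> k"
  then show "c / real n \<le> ((g ^^ (n * k)) x - x) / (real n * real k)"
    using divide_right_mono[of "real k * c" "(g ^^ (n * k)) x - x" "real n * real k"] k[of k] n by simp
qed

lemma iter_Suc_mult: "(g ^^ (n * Suc k)) x = (g ^^ n) ((g ^^ (n * k)) x)"
  by (simp add: funpow_add)

lemma rotation_le:
  assumes "n \<ge> 1" "(g ^^ n) x \<le> x + real_of_int m"
  shows "rotation \<le> real_of_int m / real n"
proof (rule rotation_le_if[OF assms(1)])
  fix k show "(g ^^ (n * k)) x \<le> x + real k * real_of_int m"
  proof (induction k)
    case (Suc k)
    have "(g ^^ (n * Suc k)) x \<le> (g ^^ n) (x + real_of_int (int k * m))"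
      unfolding iter_Suc_mult using Suc by (intro iter_mono) simp
    also have "\<dots> = (g ^^ n) x + real_of_int (int k * m)" by (rule iter_shift)
    finally show ?case using assms(2) by (simp add: algebra_simps)
  qed simp
qed

lemma rotation_ge:
  assumes "n \<ge> 1" "x + real_of_int m \<le> (g ^^ n) x"
  shows "real_of_int m / real n \<le> rotation"
proof (rule rotation_ge_if[OF assms(1)])
  fix k show "x + real k * real_of_int m \<le> (g ^^ (n * k)) x"
  proof (induction k)
    case (Suc k)
    have "(g ^^ n) x + real_of_int (int k * m) = (g ^^ n) (x + real_of_int (int k * m))"
      by (rule iter_shift[symmetric])
    also have "\<dots> \<le> (g ^^ (n * Suc k)) x"
      unfolding iter_Suc_mult using Suc by (intro iter_mono) simp
    finally show ?case using assms(2) by (simp add: algebra_simps)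
  qed simp
qed

text \<open>
  The displacement of \<open>g ^^ n\<close> is continuous and periodic; if it avoids the value \<open>m\<close>, it stays
  on one side of \<open>m\<close> and at a positive distance from it.
\<close>

lemma displacement_bounds:
  assumes "\<And>x. (g ^^ n) x \<noteq> x + real_of_int m"
  obtains \<delta> where "\<delta> > 0" "\<And>x. x + real_of_int m + \<delta> \<le> (g ^^ n) x"
  | \<delta> where "\<delta> > 0" "\<And>x. (g ^^ n) x \<le> x + real_of_int m - \<delta>"
proof -
  let ?h = "\<lambda>x. (g ^^ n) x - x - real_of_int m"
  have c: "continuous_on UNIV ?h" by (intro continuous_intros iter_cont)
  have per: "?h (x + 1) = ?h x" for x using iter_shift[of n x 1] by simp
  have "?h x \<noteq> 0" for x using assms[of x] by simp
  from nonzero_constant_sign[OF c this] show ?thesis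
  proof
    assume "\<forall>x. ?h x > 0"
    then obtain \<delta> where \<delta>: "\<delta> > 0" "\<And>x. \<delta> \<le> ?h x" using periodic_positive_bound[OF c per] by blast
    show ?thesis using that(1)[OF \<delta>(1)] \<delta>(2) by (simp add: algebra_simps)
  next
    assume neg: "\<forall>x. ?h x < 0"
    have "continuous_on UNIV (\<lambda>x. - ?h x)" by (rule continuous_on_minus[OF c])
    then obtain \<delta> where \<delta>: "\<delta> > 0" "\<And>x. \<delta> \<le> - ?h x"
      using periodic_positive_bound[of "\<lambda>x. - ?h x"] per neg by auto
    show ?thesis using that(2)[OF \<delta>(1)] \<delta>(2) by (simp add: algebra_simps)
  qed
qed

text \<open>
  Otherwise the displacement of \<open>g ^^ n\<close> is uniformly larger or uniformly smaller than \<open>m\<close>, and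
  iterating moves the rotation number away from \<open>m / n\<close>.
\<close>

lemma rational_rotation_periodic:
  assumes n: "n \<ge> 1" and rot: "rotation = real_of_int m / real n"
  obtains x where "(g ^^ n) x = x + real_of_int m"
proof (rule ccontr)
  assume "\<not> thesis"
  then have none: "(g ^^ n) x \<noteq> x + real_of_int m" for x using that by blast
  show False
  proof (rule displacement_bounds[OF none])
    fix \<delta> :: real assume \<delta>: "\<delta> > 0" "\<And>x. x + real_of_int m + \<delta> \<le> (g ^^ n) x"
    have "0 + real k * (real_of_int m + \<delta>) \<le> (g ^^ (n * k)) 0" for k
    proof (induction k)
      case (Suc k)
      then show ?case using \<delta>(2)[of "(g ^^ (n * k)) 0"] unfolding iter_Suc_mult
        by (simp add: algebra_simps)
    qed simp
    then have "(real_of_int m + \<delta>) / real n \<le> rotation" by (rule rotation_ge_if[OF n])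
    then show False using rot \<delta>(1) n by (simp add: divide_le_cancel)
  next
    fix \<delta> :: real assume \<delta>: "\<delta> > 0" "\<And>x. (g ^^ n) x \<le> x + real_of_int m - \<delta>"
    have "(g ^^ (n * k)) 0 \<le> 0 + real k * (real_of_int m - \<delta>)" for k
    proof (induction k)
      case (Suc k)
      then show ?case using \<delta>(2)[of "(g ^^ (n * k)) 0"] unfolding iter_Suc_mult
        by (simp add: algebra_simps)
    qed simp
    then have "rotation \<le> (real_of_int m - \<delta>) / real n" by (rule rotation_le_if[OF n])
    then show False using rot \<delta>(1) n by (simp add: divide_le_cancel)
  qed
qed

text \<open>
  Two of the points \<open>0, g 0, g (g 0), \<dots>\<close> have fractional parts in the same one of \<open>N\<close> equal
  subintervals of the circle.
\<close>

lemma near_return: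
  assumes \<epsilon>: "\<epsilon> > 0"
  obtains n m x where "n \<ge> 1" "\<bar>(g ^^ n) x - x - real_of_int m\<bar> < \<epsilon>"
proof -
  obtain N :: nat where N: "1 / \<epsilon> < real N" using reals_Archimedean2 by blast
  then have N0: "N > 0" using \<epsilon> by (metis divide_pos_pos less_trans of_nat_0_less_iff zero_less_one)
  let ?a = "\<lambda>k. (g ^^ k) 0"
  let ?c = "\<lambda>k. \<lfloor>real N * frac (?a k)\<rfloor>"
  have "?c k \<in> {0..<int N}" for k
    using frac_lt_1[of "?a k"] N0 by (simp add: floor_less_iff)
  then have "?c ` {0..N} \<subseteq> {0..<int N}" by blast
  then have "card (?c ` {0..N}) \<le> card {0..<int N}" by (intro card_mono) auto
  then have "\<not> inj_on ?c {0..N}" using card_image[of ?c "{0..N}"] by auto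
  then obtain i j where ij: "i < j" "?c i = ?c j" unfolding inj_on_def by (metis linorder_neqE_nat)
  have "\<bar>real N * frac (?a j) - real N * frac (?a i)\<bar> < 1" using ij(2) by linarith
  then have "real N * \<bar>frac (?a j) - frac (?a i)\<bar> < 1" by (simp add: abs_mult flip: right_diff_distrib)
  moreover have "1 < real N * \<epsilon>" using N \<epsilon> by (simp add: field_simps)
  ultimately have "real N * \<bar>frac (?a j) - frac (?a i)\<bar> < real N * \<epsilon>" by linarith
  then have "\<bar>frac (?a j) - frac (?a i)\<bar> < \<epsilon>" using N0 by simp
  moreover have "(g ^^ (j - i)) (?a i) = ?a j"
    using ij(1) funpow_add[of "j - i" i g] by simp
  ultimately have "\<bar>(g ^^ (j - i)) (?a i) - ?a i - real_of_int (\<lfloor>?a j\<rfloor> - \<lfloor>?a i\<rfloor>)\<bar> < \<epsilon>"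
    by (simp add: frac_def algebra_simps)
  then show ?thesis using that[of "j - i"] ij(1) by fastforce
qed

text \<open>
  Pigeonhole gives a return within \<open>\<epsilon>\<close>, but possibly on the upper side of \<open>x\<close>. Then
  \<open>t k\<close>, the \<open>k\<close>-th iterate of that return map, climbs in steps that never shrink below some
  \<open>\<delta>\<close>. Take the first time at which it has climbed by more than \<open>1\<close>. One turn back, the point
  reached lies between \<open>x\<close> and \<open>y = t 1\<close>: this is a return of \<open>y\<close> to within \<open>\<epsilon>\<close> from the lower side.
\<close>

lemma return_from_above:
  assumes \<epsilon>: "0 < \<epsilon>" "\<epsilon> \<le> 1"
  obtains n m x where "n \<ge> 1" "(g ^^ n) x \<le> x + real_of_int m" "x + real_of_int m < (g ^^ n) x + \<epsilon>"
proof -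
  obtain n m x where n: "n \<ge> 1" and x: "\<bar>(g ^^ n) x - x - real_of_int m\<bar> < \<epsilon>"
    using near_return[OF \<epsilon>(1)] .
  show ?thesis
  proof (cases "\<exists>y. (g ^^ n) y = y + real_of_int m")
    case True
    then obtain y where "(g ^^ n) y = y + real_of_int m" by blast
    then show ?thesis using that[OF n, of y m] \<epsilon> by simp
  next
    case False
    show ?thesis
    proof (cases "(g ^^ n) x \<le> x + real_of_int m")
      case True
      then show ?thesis using that[OF n, of x m] x by linarith
    next
      case above: False
      obtain \<delta> where \<delta>: "\<delta> > 0" "\<And>x. x + real_of_int m + \<delta> \<le> (g ^^ n) x"
        using displacement_bounds[of n m] False above by (smt (verit, best))
      define t where "t k = (g ^^ (n * k)) x - real k * real_of_int m" for k
      have t_Suc: "t (Suc k) = (g ^^ n) (t k) - real_of_int m" for k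
      proof -
        have "(g ^^ n) (t k + real_of_int (int k * m)) = (g ^^ n) (t k) + real_of_int (int k * m)"
          by (rule iter_shift)
        moreover have "t k + real_of_int (int k * m) = (g ^^ (n * k)) x" by (simp add: t_def)
        ultimately have "(g ^^ n) ((g ^^ (n * k)) x) = (g ^^ n) (t k) + real_of_int (int k * m)" by metis
        then show ?thesis unfolding t_def[of "Suc k"] iter_Suc_mult by (simp add: algebra_simps)
      qed
      have t0: "t 0 = x" by (simp add: t_def)
      have t1: "x < t 1" "t 1 < x + \<epsilon>" using above x t_Suc[of 0] t0 by auto
      have grow: "x + real k * \<delta> \<le> t k" for k
      proof (induction k)
        case (Suc k)
        then show ?case using \<delta>(2)[of "t k"] by (simp add: t_Suc algebra_simps)
      qed (simp add: t0)
      obtain K0 :: nat where "1 / \<delta> < real K0" using reals_Archimedean2 by blast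
      then have "x + 1 < t K0" using grow[of K0] \<delta>(1) by (simp add: field_simps)
      then have ex: "\<exists>k. x + 1 < t k" by blast
      \<comment> \<open>the first time at which the orbit has climbed by more than a full turn\<close>
      define L where "L = (LEAST k. x + 1 < t k)"
      have L: "x + 1 < t L" unfolding L_def by (rule LeastI_ex[OF ex])
      have L_min: "t k \<le> x + 1" if "k < L" for k
        using not_less_Least[of k "\<lambda>k. x + 1 < t k"] that unfolding L_def by force
      have "L \<noteq> 0" "L \<noteq> 1" using L t0 t1 \<epsilon>(2) by (metis add.commute add_le_cancel_left less_add_one not_less_iff_gr_or_eq, auto)
      then obtain K where K: "L = Suc K" "K \<ge> 1" by (cases L) auto
      define y where "y = t 1"
      have y_iter: "(g ^^ (n * K)) y = t L + real K * real_of_int m"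
      proof -
        have "y = (g ^^ n) x + real_of_int (- m)" unfolding y_def using t_Suc[of 0] t0 by simp
        then have "(g ^^ (n * K)) y = (g ^^ (n * K)) ((g ^^ n) x) + real_of_int (- m)"
          by (metis iter_shift)
        also have "(g ^^ (n * K)) ((g ^^ n) x) = (g ^^ (n * L)) x"
          unfolding K(1) by (simp add: funpow_add[symmetric] add.commute flip: comp_apply[of "g ^^ (n * K)" "g ^^ n"])
        finally show ?thesis unfolding t_def K(1) by (simp add: algebra_simps)
      qed
      have "t L = (g ^^ n) (t K) - real_of_int m" using t_Suc K(1) by simp
      also have "\<dots> \<le> (g ^^ n) (x + real_of_int 1) - real_of_int m"
        using L_min[of K] K(1) by (intro diff_right_mono iter_mono) simp
      also have "\<dots> = y + 1" unfolding iter_shift y_def using t_Suc[of 0] t0 by simp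
      finally have "t L \<le> y + 1" .
      then have "(g ^^ (n * K)) y \<le> y + real_of_int (int K * m + 1)" using y_iter by simp
      moreover have "y + real_of_int (int K * m + 1) < (g ^^ (n * K)) y + \<epsilon>"
        using y_iter L t1 unfolding y_def by simp
      ultimately show ?thesis using that[of "n * K" y "int K * m + 1"] n K(2) by simp
    qed
  qed
qed

end

text \<open>
  Pick \<open>x\<close> and \<open>m\<close> such that \<open>g ^^ n\<close> brings \<open>x\<close> back to \<open>x + m\<close> or slightly below. Since
  \<open>h ^^ n\<close> is larger than \<open>g ^^ n\<close> by more than that amount, it moves \<open>x\<close> beyond \<open>x + m\<close>. So
  \<open>m / n\<close> separates the two rotation numbers, and it equals both if they agree.
\<close>

lemma equal_rotation_rational:
  assumes "circle_lift g" "circle_lift h" and less: "\<And>x. g x < h x"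
    and eq: "circle_lift.rotation g = circle_lift.rotation h"
  obtains n m where "n \<ge> 1" "circle_lift.rotation g = real_of_int m / real n"
proof -
  interpret g: circle_lift g by fact
  interpret h: circle_lift h by fact
  have "continuous_on UNIV (\<lambda>x. h x - g x)" by (intro continuous_intros g.cont h.cont)
  then obtain \<delta> where \<delta>: "\<delta> > 0" "\<And>x. \<delta> \<le> h x - g x"
    using periodic_positive_bound[of "\<lambda>x. h x - g x"] less g.degree_one h.degree_one by auto
  have iter: "(g ^^ n) x + \<delta> \<le> (h ^^ n) x" if "n \<ge> 1" for n x
    using that
  proof (induction n rule: dec_induct)
    case base
    then show ?case using \<delta>(2)[of x] by simp
  next
    case (step n)
    have "g ((g ^^ n) x) + \<delta> \<le> h ((g ^^ n) x)" using \<delta>(2)[of "(g ^^ n) x"] by simp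
    also have "\<dots> \<le> h ((h ^^ n) x)" using step \<delta>(1) by (intro monoD[OF strict_mono_mono[OF h.smono]]) simp
    finally show ?case by simp
  qed
  have "0 < min \<delta> 1" "min \<delta> 1 \<le> 1" using \<delta>(1) by auto
  then obtain n m x where n: "n \<ge> 1" "(g ^^ n) x \<le> x + real_of_int m"
    "x + real_of_int m < (g ^^ n) x + min \<delta> 1"
    by (rule g.return_from_above)
  then have "x + real_of_int m \<le> (h ^^ n) x" using iter[OF n(1), of x] by simp
  then have "real_of_int m / real n \<le> h.rotation" by (rule h.rotation_ge[OF n(1)])
  moreover have "g.rotation \<le> real_of_int m / real n" by (rule g.rotation_le[OF n(1,2)])
  ultimately show ?thesis using that[OF n(1), of m] eq by simp
qed

section \<open>Loops in the line and on simple closed curves\<close>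

text \<open>
  The values between \<open>h 0\<close> and \<open>h (1/2)\<close> are attained on both halves of the interval.
\<close>

lemma continuous_loop_not_injective:
  fixes h :: "real \<Rightarrow> real"
  assumes h: "continuous_on {0..1} h" and loop: "h 0 = h 1"
  obtains s t where "0 \<le> s" "s < t" "t < 1" "h s = h t"
proof -
  have main: "\<exists>s t. 0 \<le> s \<and> s < t \<and> t < 1 \<and> h s = h t"
    if h: "continuous_on {0..1} h" and loop: "h 0 = h 1" and lt: "h 0 < h (1/2)" for h :: "real \<Rightarrow> real"
  proof -
    define c where "c = (h 0 + h (1/2)) / 2"
    have c: "h 0 < c" "c < h (1/2)" using lt by (auto simp: c_def)
    have "\<exists>s\<ge>0. s \<le> 1/2 \<and> h s = c"
      using c by (intro IVT' continuous_on_subset[OF h]) auto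
    then obtain s where s: "0 \<le> s" "s \<le> 1/2" "h s = c" by blast
    have "\<exists>t\<ge>1/2. t \<le> 1 \<and> h t = c"
      using c loop by (intro IVT2' continuous_on_subset[OF h]) auto
    then obtain t where t: "1/2 \<le> t" "t \<le> 1" "h t = c" by blast
    have "s \<noteq> 1/2" using s(3) c(2) by (metis less_irrefl)
    moreover have "t \<noteq> 1" using t(3) c(1) loop by (metis less_irrefl)
    moreover note s t
    ultimately show ?thesis by (intro exI[of _ s] exI[of _ t]) auto
  qed
  consider "h 0 = h (1/2)" | "h 0 < h (1/2)" | "- h 0 < - h (1/2)" by linarith
  then show ?thesis
  proof cases
    case 1
    then show ?thesis using that[of 0 "1/2"] by auto
  next
    case 2
    then show ?thesis using main[OF h loop] that by blast
  next
    case 3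
    have "continuous_on {0..1} (\<lambda>t. - h t)" by (intro continuous_intros h)
    then show ?thesis using main[of "\<lambda>t. - h t"] loop 3 that by auto
  qed
qed

text \<open>
  Without one of its points a simple closed curve is an open arc, and an open arc contains no
  simple closed curve: its parametrisation would turn it into an injective loop in the line.
\<close>

lemma simple_closed_path_image_eq:
  fixes g h :: "real \<Rightarrow> 'a::metric_space"
  assumes g: "simple_path g" "pathfinish g = pathstart g"
    and h: "simple_path h" "pathfinish h = pathstart h"
    and sub: "path_image h \<subseteq> path_image g"
  shows "path_image h = path_image g"
proof (rule ccontr)
  assume "\<not> ?thesis"
  then obtain s where s: "s \<in> {0..1}" "g s \<notin> path_image h" using sub unfolding path_image_def by blast
  \<comment> \<open>reparametrise such that the omitted point is the base point\<close>
  define k where "k = shiftpath s g"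
  have k: "simple_path k" "path_image k = path_image g" "k 0 = g s" "k 1 = g s"
  proof -
    show "simple_path k" "path_image k = path_image g"
      unfolding k_def using g s(1) by (simp_all add: simple_path_shiftpath path_image_shiftpath)
    have "pathstart k = g s" "pathfinish k = g s"
      unfolding k_def using g s(1) by (auto simp: pathstart_shiftpath pathfinish_shiftpath)
    then show "k 0 = g s" "k 1 = g s" by (auto simp: pathstart_def pathfinish_def)
  qed
  have kc: "continuous_on {0..1} k" using k(1) by (simp add: simple_path_def path_def)
  let ?T = "{0..1} \<inter> k -` path_image h"
  have "compact (path_image h)" using h(1) by (simp add: compact_simple_path_image)
  then have "closed ?T" by (intro continuous_closed_preimage kc compact_imp_closed) auto
  then have T: "compact ?T" by (simp add: compact_eq_bounded_closed bounded_Int)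
  have T01: "t \<noteq> 0 \<and> t \<noteq> 1" if "t \<in> ?T" for t using that k(3,4) s(2) by auto
  have inj: "inj_on k ?T"
    using k(1) T01 unfolding simple_path_def loop_free_def inj_on_def by blast
  have img: "k ` ?T = path_image h"
  proof
    show "path_image h \<subseteq> k ` ?T"
    proof
      fix w assume w: "w \<in> path_image h"
      then have "w \<in> path_image k" using sub k(2) by auto
      then obtain t where "t \<in> {0..1}" "w = k t" unfolding path_image_def by blast
      then show "w \<in> k ` ?T" using w by (intro image_eqI[of _ _ t]) auto
    qed
  qed auto
  define \<tau> where "\<tau> = inv_into ?T k"
  have "continuous_on (k ` ?T) \<tau>"
    by (rule continuous_on_inv[OF continuous_on_subset[OF kc] T]) (auto simp: \<tau>_def inv_into_f_f[OF inj])
  then have \<tau>: "continuous_on (path_image h) \<tau>" using img by simp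
  have hc: "continuous_on {0..1} h" using h(1) by (simp add: simple_path_def path_def)
  have "continuous_on {0..1} (\<tau> \<circ> h)"
    using hc \<tau> by (intro continuous_on_compose) (auto simp: path_image_def)
  moreover have "(\<tau> \<circ> h) 0 = (\<tau> \<circ> h) 1" using h(2) by (simp add: pathstart_def pathfinish_def)
  ultimately obtain a b where ab: "0 \<le> a" "a < b" "b < 1" "(\<tau> \<circ> h) a = (\<tau> \<circ> h) b"
    by (rule continuous_loop_not_injective)
  have "k (\<tau> (h t)) = h t" if "t \<in> {0..1}" for t
    unfolding \<tau>_def using that img by (intro f_inv_into_f) (auto simp: path_image_def)
  then have "h a = h b" using ab by (metis atLeastAtMost_iff comp_apply less_eq_real_def order_trans)
  then show False using h(1) ab unfolding simple_path_def loop_free_def by fastforce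
qed

section \<open>Directions and their lifted angles\<close>

text \<open>
  \<open>\<theta>\<close> is one of the real values of the argument of the vector from \<open>p\<close> to \<open>q\<close>; they differ by
  multiples of \<open>2 * pi\<close>.
\<close>

definition angle :: "real \<times> real \<Rightarrow> real \<times> real \<Rightarrow> real \<Rightarrow> bool" where
  "angle p q \<theta> \<longleftrightarrow>
     (\<exists>r>0. fst q - fst p = r * cos \<theta> \<and> snd q - snd p = r * sin \<theta>)"

text \<open>
  The angles of vertical directions, indexed such that even numbers stand for upwards and odd
  numbers for downwards.
\<close>

definition vertical :: "int \<Rightarrow> real" where
  "vertical m = real_of_int m * pi + pi / 2"

lemma vertical_less_iff [simp]: "vertical m < vertical n \<longleftrightarrow> m < n"
  by (simp add: vertical_def)

lemma vertical_le_iff [simp]: "vertical m \<le> vertical n \<longleftrightarrow> m \<le> n"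
  by (simp add: vertical_def)

lemma angle_flip:
  assumes "angle p q \<theta>"
  shows "angle q p (\<theta> - pi)"
proof -
  obtain r where "r > 0" "fst q - fst p = r * cos \<theta>" "snd q - snd p = r * sin \<theta>"
    using assms unfolding angle_def by blast
  then show ?thesis unfolding angle_def
    by (intro exI[of _ r]) (auto simp: cos_diff sin_diff)
qed

lemma angle_minus_2pi:
  assumes "angle p q \<theta>"
  shows "angle p q (\<theta> - 2 * pi * real_of_int k)"
proof -
  have "cos (\<theta> - 2 * pi * real_of_int k) = cos \<theta>" "sin (\<theta> - 2 * pi * real_of_int k) = sin \<theta>"
    by (simp_all add: cos_diff sin_diff)
  then show ?thesis using assms unfolding angle_def by simp
qed

lemma angle_minus_pi:
  assumes "angle p q \<theta>"
  shows "if even m then angle p q (\<theta> - real_of_int m * pi) else angle q p (\<theta> - real_of_int m * pi)"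
proof (cases "even m")
  case True
  then obtain k where "m = 2 * k" by blast
  then show ?thesis using angle_minus_2pi[OF assms, of k] True by (simp add: algebra_simps)
next
  case False
  then obtain k where "m = 2 * k + 1" using oddE by blast
  then show ?thesis using angle_flip[OF angle_minus_2pi[OF assms, of k]] False
    by (simp add: algebra_simps)
qed

lemma angle_right:
  assumes "angle p q \<theta>" "- (pi / 2) < \<theta>" "\<theta> < pi / 2"
  shows "fst p < fst q"
proof -
  obtain r where r: "r > 0" "fst q - fst p = r * cos \<theta>" using assms unfolding angle_def by blast
  have "cos \<theta> > 0" using assms by (intro cos_gt_zero_pi) auto
  then have "r * cos \<theta> > 0" using r by simp
  then show ?thesis using r by linarith
qed

lemma angle_up:
  assumes "angle p q (pi / 2)"
  shows "fst p = fst q" "snd p < snd q"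
  using assms unfolding angle_def by auto

lemma angle_left:
  assumes "angle p q \<theta>" "pi / 2 \<le> \<theta>" "\<theta> \<le> 3 * pi / 2"
  shows "fst q \<le> fst p"
proof -
  obtain r where r: "r > 0" "fst q - fst p = r * cos \<theta>" using assms unfolding angle_def by blast
  have "cos (\<theta> - pi) \<ge> 0" using assms by (intro cos_ge_zero) auto
  then have "cos \<theta> \<le> 0" by (simp add: cos_diff)
  then have "r * cos \<theta> \<le> 0" using r by (simp add: mult_nonneg_nonpos)
  then show ?thesis using r by linarith
qed

lemma angle_of_left_point:
  assumes "angle p q \<theta>" "fst q < fst p" "- (3 * pi / 2) \<le> \<theta>" "\<theta> \<le> pi / 2"
  shows "vertical (-2) < \<theta>" "\<theta> < vertical (-1)"
proof -
  obtain r where r: "r > 0" "fst q - fst p = r * cos \<theta>" using assms unfolding angle_def by blast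
  have c: "cos \<theta> < 0" using r assms(2) by (smt (verit) zero_le_mult_iff)
  have "\<theta> < - (pi / 2)"
  proof (rule ccontr)
    assume "\<not> ?thesis"
    then have "cos \<theta> \<ge> 0" using assms by (intro cos_ge_zero) auto
    with c show False by simp
  qed
  moreover have "\<theta> \<noteq> - (3 * pi / 2)"
  proof
    assume \<theta>: "\<theta> = - (3 * pi / 2)"
    have "- (3 * pi / 2) = - (pi + pi / 2)" by (simp add: field_simps)
    then have "cos \<theta> = cos (pi + pi / 2)" using \<theta> by (metis cos_minus)
    moreover have "cos (pi + pi / 2) = 0" by (simp only: cos_add) simp
    ultimately have "cos \<theta> = 0" by simp
    with c show False by simp
  qed
  ultimately show "vertical (-2) < \<theta>" "\<theta> < vertical (-1)" using assms(3) by (auto simp: vertical_def)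
qed

lemma angle_of_upper_point:
  assumes "angle p q \<theta>" "fst q = fst p" "snd p < snd q" "vertical (-2) < \<theta>" "\<theta> < vertical 0"
  shows False
proof -
  obtain r where r: "r > 0" "fst q - fst p = r * cos \<theta>" "snd q - snd p = r * sin \<theta>"
    using assms unfolding angle_def by blast
  have c: "cos \<theta> = 0" using r assms by simp
  have s: "sin \<theta> > 0" using r assms(3) by (smt (verit) zero_less_mult_iff)
  have b: "- (3 * pi / 2) < \<theta>" "\<theta> < pi / 2" using assms by (auto simp: vertical_def)
  have "\<theta> = - (pi / 2)"
  proof (rule ccontr)
    assume n: "\<theta> \<noteq> - (pi / 2)"
    show False
    proof (cases "\<theta> > - (pi / 2)")
      case True
      then have "cos \<theta> > 0" using b by (intro cos_gt_zero_pi) auto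
      then show False using c by simp
    next
      case False
      then have "cos (\<theta> + pi) > 0" using b n by (intro cos_gt_zero_pi) auto
      then show False using c by (simp add: cos_add)
    qed
  qed
  then show False using s by simp
qed

lemma angle_lift:
  fixes g :: "real \<Rightarrow> real \<times> real"
  assumes g: "continuous_on {0..1} g" and p: "p \<notin> g ` {0..1}"
  obtains \<theta> where "continuous_on {0..1} \<theta>" "\<And>t. t \<in> {0..1} \<Longrightarrow> angle (g t) p (\<theta> t)"
proof -
  let ?h = "\<lambda>t. Complex (fst p - fst (g t)) (snd p - snd (g t))"
  have h: "continuous_on {0..1} ?h" unfolding Complex_eq
    by (intro continuous_intros g)
  have nz: "?h t \<noteq> 0" if "t \<in> {0..1}" for t
    using p that by (auto simp: complex_eq_iff prod_eq_iff image_iff)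
  obtain q where q: "continuous_on {0..1} q" "\<And>t. t \<in> {0..1} \<Longrightarrow> ?h t = exp (q t)"
    using continuous_logarithm_on_contractible[OF h _ nz] convex_imp_contractible[of "{0..1::real}"]
    by (metis convex_real_interval(5))
  show ?thesis
  proof
    show "continuous_on {0..1} (\<lambda>t. Im (q t))" by (intro continuous_intros q)
    fix t :: real assume "t \<in> {0..1}"
    then have "?h t = exp (q t)" by (rule q)
    then have "Re (?h t) = exp (Re (q t)) * cos (Im (q t))" "Im (?h t) = exp (Re (q t)) * sin (Im (q t))"
      by (simp_all only: Re_exp Im_exp)
    then show "angle (g t) p (Im (q t))" unfolding angle_def
      by (intro exI[of _ "exp (Re (q t))"]) auto
  qed
qed

text \<open>
  At the end of the path \<open>p\<close> lies to the left, so a multiple of \<open>2 * pi\<close> brings the final angle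
  into the interval between \<open>- 3 * pi / 2\<close> and \<open>- pi / 2\<close>. This common normalisation makes the
  angles of different iterates comparable.
\<close>

lemma angle_lift_normalized:
  fixes g :: "real \<Rightarrow> real \<times> real"
  assumes g: "continuous_on {0..1} g" and p: "p \<notin> g ` {0..1}" and far: "fst p < fst (g 1)"
  obtains \<theta> where "continuous_on {0..1} \<theta>" "\<And>t. t \<in> {0..1} \<Longrightarrow> angle (g t) p (\<theta> t)"
    "vertical (-2) < \<theta> 1" "\<theta> 1 < vertical (-1)"
proof -
  \<comment> \<open>any lift, to be shifted into the window of length \<open>2 * pi\<close> that starts at \<open>- 3 * pi / 2\<close>\<close>
  obtain \<theta> where \<theta>: "continuous_on {0..1} \<theta>" "\<And>t. t \<in> {0..1} \<Longrightarrow> angle (g t) p (\<theta> t)"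
    using angle_lift[OF g p] by blast
  define k where "k = \<lfloor>(\<theta> 1 + 3 * pi / 2) / (2 * pi)\<rfloor>"
  define \<theta>' where "\<theta>' t = \<theta> t - 2 * pi * real_of_int k" for t
  have a: "angle (g t) p (\<theta>' t)" if "t \<in> {0..1}" for t
    unfolding \<theta>'_def using angle_minus_2pi[OF \<theta>(2)[OF that]] .
  have "real_of_int k \<le> (\<theta> 1 + 3 * pi / 2) / (2 * pi)" "(\<theta> 1 + 3 * pi / 2) / (2 * pi) < real_of_int k + 1"
    unfolding k_def by linarith+
  then have "- (3 * pi / 2) \<le> \<theta>' 1" "\<theta>' 1 \<le> pi / 2"
    unfolding \<theta>'_def by (auto simp: field_simps)
  then have "vertical (-2) < \<theta>' 1" "\<theta>' 1 < vertical (-1)"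
    using angle_of_left_point[OF a[of 1] far] by auto
  moreover have "continuous_on {0..1} \<theta>'" unfolding \<theta>'_def by (intro continuous_intros \<theta>)
  ultimately show ?thesis using a that by blast
qed

text \<open>
  The vector with angle \<open>\<theta>'\<close> has not reached any vertical direction that the vector with angle
  \<open>\<theta>\<close> has not passed. With coherent choices of the angles, a twist map relates the vector between
  two points and the vector between their images in this way.
\<close>

definition lags :: "real \<Rightarrow> real \<Rightarrow> bool" where
  "lags \<theta> \<theta>' \<longleftrightarrow> (\<forall>m. \<theta> \<le> vertical m \<longrightarrow> \<theta>' < vertical m)"

lemma vertical_bracket:
  obtains m where "vertical (m - 1) < \<theta>" "\<theta> \<le> vertical m"
proof
  let ?m = "\<lceil>(\<theta> - pi / 2) / pi\<rceil>"
  have "(\<theta> - pi / 2) / pi \<le> real_of_int ?m" "real_of_int (?m - 1) < (\<theta> - pi / 2) / pi" by linarith+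
  then have "\<theta> - pi / 2 \<le> real_of_int ?m * pi" "real_of_int (?m - 1) * pi < \<theta> - pi / 2"
    by (simp_all only: pos_divide_le_eq pos_less_divide_eq pi_gt_zero)
  then show "vertical (?m - 1) < \<theta>" "\<theta> \<le> vertical ?m"
    by (simp_all only: vertical_def)
qed

text \<open>
  The hypotheses keep the pair of angles off a staircase-shaped set that separates the pairs
  with \<open>lags\<close> from the others: they exclude \<open>b = vertical m\<close> for \<open>a\<close> strictly between two verticals,
  and a whole interval of values of \<open>b\<close> when \<open>a\<close> is vertical.
\<close>

lemma lags_locally_constant:
  assumes 1: "\<And>m. vertical (m - 1) < a \<Longrightarrow> a < vertical m \<Longrightarrow> b \<noteq> vertical m"
    and 2: "\<And>m. a = vertical m \<Longrightarrow> vertical m \<le> b \<Longrightarrow> b \<le> vertical (m + 1) \<Longrightarrow> False"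
  shows "\<exists>W. open W \<and> (a, b) \<in> W \<and> (\<forall>w\<in>W. \<forall>w'\<in>W. lags (fst w) (snd w) \<longrightarrow> lags (fst w') (snd w'))"
proof -
  obtain m where m: "vertical (m - 1) < a" "a \<le> vertical m" using vertical_bracket .
  consider "b < vertical m" | "b \<ge> vertical m" "a < vertical m" | "b \<ge> vertical m" "a = vertical m"
    using m by linarith
  then show ?thesis
  proof cases
    case 1
    let ?W = "{vertical (m-1)<..} \<times> {..<vertical m}"
    have "lags (fst w) (snd w)" if "w \<in> ?W" for w
      unfolding lags_def
    proof (intro allI impI)
      fix k assume "fst w \<le> vertical k"
      moreover have "vertical (m - 1) < fst w" using that by (simp add: mem_Times_iff)
      ultimately have "vertical (m - 1) < vertical k" by (rule less_le_trans[rotated])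
      then have "vertical m \<le> vertical k" by simp
      moreover have "snd w < vertical m" using that by (simp add: mem_Times_iff)
      ultimately show "snd w < vertical k" by (rule less_le_trans[rotated])
    qed
    moreover have "open ?W" "(a, b) \<in> ?W" using m 1 by (auto intro: open_Times)
    ultimately show ?thesis by (intro exI[of _ ?W]) blast
  next
    case 2
    then have b: "b > vertical m" using 1[OF m(1)] by force
    let ?W = "{..<vertical m} \<times> {vertical m<..}"
    have "\<not> lags (fst w) (snd w)" if "w \<in> ?W" for w
      using that unfolding lags_def by (auto simp: mem_Times_iff intro!: exI[of _ m])
    moreover have "open ?W" "(a, b) \<in> ?W" using 2 b by (auto intro: open_Times)
    ultimately show ?thesis by (intro exI[of _ ?W]) blast
  next
    case 3
    then have b: "b > vertical (m+1)" using 2[of m] by force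
    let ?W = "{..<vertical (m+1)} \<times> {vertical (m+1)<..}"
    have "\<not> lags (fst w) (snd w)" if "w \<in> ?W" for w
      using that unfolding lags_def by (auto simp: mem_Times_iff intro!: exI[of _ "m+1"])
    moreover have "open ?W" "(a, b) \<in> ?W" using 3 b by (auto intro: open_Times)
    ultimately show ?thesis by (intro exI[of _ ?W]) blast
  qed
qed

text \<open>
  The relation is propagated from the end of the path by connectedness.
\<close>

lemma lags_path:
  fixes a b :: "real \<Rightarrow> real"
  assumes cont: "continuous_on {0..1} a" "continuous_on {0..1} b"
    and 1: "\<And>m t. t \<in> {0..1} \<Longrightarrow> vertical (m - 1) < a t \<Longrightarrow> a t < vertical m \<Longrightarrow> b t \<noteq> vertical m"
    and 2: "\<And>m t. t \<in> {0..1} \<Longrightarrow> a t = vertical m \<Longrightarrow> vertical m \<le> b t \<Longrightarrow> b t \<le> vertical (m + 1) \<Longrightarrow> False"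
    and end1: "lags (a 1) (b 1)" and t: "t \<in> {0..1}"
  shows "lags (a t) (b t)"
proof -
  have local: "\<exists>T. openin (top_of_set {0..1}) T \<and> s \<in> T \<and>
            (\<forall>x\<in>T. \<forall>y\<in>T. lags (a x) (b x) \<longrightarrow> lags (a y) (b y))" if s: "s \<in> {0..1}" for s
  proof -
    obtain W where W: "open W" "(a s, b s) \<in> W"
      "\<forall>w\<in>W. \<forall>w'\<in>W. lags (fst w) (snd w) \<longrightarrow> lags (fst w') (snd w')"
    proof -
      have "\<exists>W. open W \<and> (a s, b s) \<in> W \<and>
          (\<forall>w\<in>W. \<forall>w'\<in>W. lags (fst w) (snd w) \<longrightarrow> lags (fst w') (snd w'))"
        by (rule lags_locally_constant) (use 1 2 s in blast)+
      then show ?thesis using that by blast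
    qed
    let ?T = "{0..1} \<inter> (\<lambda>t. (a t, b t)) -` W"
    have "openin (top_of_set {0..1}) ?T"
      by (intro continuous_openin_preimage_gen continuous_on_Pair cont W(1))
    moreover have "s \<in> ?T" using s W by auto
    moreover have "\<forall>x\<in>?T. \<forall>y\<in>?T. lags (a x) (b x) \<longrightarrow> lags (a y) (b y)"
    proof (intro ballI impI)
      fix x y assume "x \<in> ?T" "y \<in> ?T" "lags (a x) (b x)"
      then show "lags (a y) (b y)"
        using W(3)[rule_format, of "(a x, b x)" "(a y, b y)"] by simp
    qed
    ultimately show ?thesis by blast
  qed
  have "connected {0..1::real}" by simp
  from connected_induction_simple[OF this _ t, of 1 "\<lambda>t. lags (a t) (b t)"] local end1
  show ?thesis by simp
qed

section \<open>Twist homeomorphisms of the plane\<close>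

lemma vertical_0: "vertical 0 = pi / 2" by (simp add: vertical_def)

lemma vertical_minus_2: "vertical (-2) + 2 * pi = pi / 2" by (simp add: vertical_def)

lemma add_Pair_zero [simp]: "z + (0, 0) = (z :: real \<times> real)"
  by (simp add: prod_eq_iff)

text \<open>
  The last two conditions say that \<open>F\<close> tilts vertical segments to the right and that its inverse
  tilts them to the left.
\<close>

locale twist_plane =
  fixes F :: "real \<times> real \<Rightarrow> real \<times> real"
  assumes cont: "continuous_on UNIV F"
    and bij: "bij F"
    and shift: "F (z + (1, 0)) = F z + (1, 0)"
    and twist: "y < y' \<Longrightarrow> fst (F (x, y)) < fst (F (x, y'))"
    and untwist: "fst (F p) = fst (F q) \<Longrightarrow> snd (F p) < snd (F q) \<Longrightarrow> fst q < fst p"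
begin

lemma F_eq_iff [simp]: "F p = F q \<longleftrightarrow> p = q"
  using bij by (metis bij_def injD)

lemma iter_eq_iff [simp]: "(F ^^ n) p = (F ^^ n) q \<longleftrightarrow> p = q"
  by (induction n) auto

lemma cont_iter: "continuous_on A (F ^^ n)"
proof (induction n)
  case (Suc n)
  have "continuous_on A (F \<circ> (F ^^ n))"
    by (rule continuous_on_compose[OF Suc continuous_on_subset[OF cont]]) simp
  then show ?case by simp
qed (simp add: id_def)

lemma shift_iter_nat: "(F ^^ n) (z + (real k, 0)) = (F ^^ n) z + (real k, 0)"
proof -
  have one: "(F ^^ n) (z + (1, 0)) = (F ^^ n) z + (1, 0)" for z
    by (induction n) (auto simp: shift)
  show ?thesis
  proof (induction k)
    case 0
    then show ?case by (simp add:)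
  next
    case (Suc k)
    have "z + (real (Suc k), 0) = (z + (real k, 0)) + (1, 0)" by (simp add: prod_eq_iff)
    then have "(F ^^ n) (z + (real (Suc k), 0)) = (F ^^ n) (z + (real k, 0)) + (1, 0)"
      by (simp only: one)
    then show ?case using Suc by (simp add: prod_eq_iff)
  qed
qed

lemma shift_iter: "(F ^^ n) (z + (real_of_int k, 0)) = (F ^^ n) z + (real_of_int k, 0)"
proof (cases "k \<ge> 0")
  case True
  then show ?thesis using shift_iter_nat[of n z "nat k"] by simp
next
  case False
  then have "(F ^^ n) z = (F ^^ n) (z + (real_of_int k, 0)) + (- real_of_int k, 0)"
    using shift_iter_nat[of n "z + (real_of_int k, 0)" "nat (- k)"] by (simp add: prod_eq_iff add.assoc)
  then show ?thesis by (simp add: prod_eq_iff)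
qed

lemma angle_image_not_up:
  assumes "angle p q a" "angle (F p) (F q) b" "- (pi / 2) < a" "a < pi / 2"
  shows "b \<noteq> pi / 2"
proof
  assume "b = pi / 2"
  with assms(2) have "angle (F p) (F q) (pi / 2)" by (simp only:)
  then have "fst q < fst p" using angle_up[of "F p" "F q"] untwist[of p q] by auto
  then show False using angle_right[OF assms(1,3,4)] by simp
qed

lemma angle_image_of_up:
  assumes "angle p q (pi / 2)" "angle (F p) (F q) b" "pi / 2 \<le> b" "b \<le> 3 * pi / 2"
  shows False
proof -
  have q: "q = (fst p, snd q)" "snd p < snd q" using angle_up[OF assms(1)] by (auto simp: prod_eq_iff)
  have "fst (F p) < fst (F q)" using twist[OF q(2), of "fst p"] q(1) by simp
  then show False using angle_left[OF assms(2-4)] by simp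
qed

text \<open>
  The image of a vector pointing to the right is never vertical upwards, because the inverse
  tilts vertical vectors to the left; exchanging the two points covers all parities of \<open>m\<close>.
\<close>

lemma vertical_barrier:
  assumes "angle p q a" "angle (F p) (F q) b" "vertical (m - 1) < a" "a < vertical m"
  shows "b \<noteq> vertical m"
proof
  assume b: "b = vertical m"
  have "- (pi / 2) < a - real_of_int m * pi" "a - real_of_int m * pi < pi / 2"
    using assms(3,4) by (auto simp: vertical_def algebra_simps)
  moreover have "b - real_of_int m * pi = pi / 2" using b by (simp add: vertical_def)
  ultimately show False
    using angle_minus_pi[OF assms(1), of m] angle_minus_pi[OF assms(2), of m]
      angle_image_not_up by (metis (full_types))
qed

lemma vertical_crossing:
  assumes "angle p q a" "angle (F p) (F q) b" "a = vertical m"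
    "vertical m \<le> b" "b \<le> vertical (m + 1)"
  shows False
proof -
  have "a - real_of_int m * pi = pi / 2" using assms(3) by (simp add: vertical_def)
  moreover have "pi / 2 \<le> b - real_of_int m * pi" "b - real_of_int m * pi \<le> 3 * pi / 2"
    using assms(4,5) by (auto simp: vertical_def algebra_simps)
  ultimately show False
    using angle_minus_pi[OF assms(1), of m] angle_minus_pi[OF assms(2), of m]
      angle_image_of_up by (metis (full_types))
qed

end

section \<open>Points below an invariant set\<close>

text \<open>
  The set \<open>K\<close> stands for the full preimage of an essential invariant curve in the strip. Of such a
  curve the following arguments retain, besides closedness and invariance, that one can travel
  within \<open>K\<close> from each point to some of its translates, arbitrarily far in both directions.
\<close>

locale invariant_set = twist_plane +
  fixes K :: "(real \<times> real) set"
  assumes closed: "closed K"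
    and sub_strip: "K \<subseteq> strip"
    and nonempty: "K \<noteq> {}"
    and inv: "F z \<in> K \<longleftrightarrow> z \<in> K"
    and shift_K: "z + (1, 0) \<in> K \<longleftrightarrow> z \<in> K"
    and travel: "\<exists>k::nat>0. \<forall>z\<in>K. path_component K z (z + (real k, 0))"
begin

definition below :: "(real \<times> real) set" where
  "below = {z. \<forall>c\<in>K. fst c = fst z \<longrightarrow> snd z < snd c}"

lemma inv_iter: "(F ^^ n) z \<in> K \<longleftrightarrow> z \<in> K"
  by (induction n) (auto simp: inv)

lemma shift_K_nat: "z + (real k, 0) \<in> K \<longleftrightarrow> z \<in> K"
proof (induction k)
  case (Suc k)
  have "z + (real (Suc k), 0) = (z + (real k, 0)) + (1, 0)" by (simp add: prod_eq_iff)
  then have "z + (real (Suc k), 0) \<in> K \<longleftrightarrow> z + (real k, 0) \<in> K" by (simp only: shift_K)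
  then show ?case using Suc by simp
qed simp

lemma shift_K_int: "z + (real_of_int k, 0) \<in> K \<longleftrightarrow> z \<in> K"
proof (cases "k \<ge> 0")
  case True
  then show ?thesis using shift_K_nat[of z "nat k"] by simp
next
  case False
  then show ?thesis using shift_K_nat[of "z + (real_of_int k, 0)" "nat (- k)"]
    by (simp add: add.assoc)
qed

lemma shift_below: "z + (real_of_int k, 0) \<in> below \<longleftrightarrow> z \<in> below"
proof -
  have *: "z + (real_of_int k, 0) \<in> below" if "z \<in> below" for z k
    unfolding below_def
  proof (intro CollectI ballI impI)
    fix c assume "c \<in> K" "fst c = fst (z + (real_of_int k, 0))"
    moreover from this have "c = (fst z, snd c) + (real_of_int k, 0)" by (simp add: prod_eq_iff)
    ultimately have "(fst z, snd c) + (real_of_int k, 0) \<in> K" by metis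
    then have "(fst z, snd c) \<in> K" using shift_K_int by blast
    then show "snd (z + (real_of_int k, 0)) < snd c" using that by (auto simp: below_def)
  qed
  show ?thesis using *[of z k] *[of "z + (real_of_int k, 0)" "- k"]
    by (auto simp: add.assoc)
qed

lemma below_not_K: "z \<in> below \<Longrightarrow> z \<notin> K"
  unfolding below_def by auto

lemma travel_far:
  obtains k :: nat where "k > 0" "\<And>z n. z \<in> K \<Longrightarrow> path_component K z (z + (real (n * k), 0))"
proof -
  obtain k :: nat where k: "k > 0" "\<And>z. z \<in> K \<Longrightarrow> path_component K z (z + (real k, 0))"
    using travel by blast
  have "path_component K z (z + (real (n * k), 0))" if "z \<in> K" for z n
  proof (induction n)
    case 0
    then show ?case using that by (simp add: path_component_refl)
  next
    case (Suc n)
    have "z + (real (n * k), 0) \<in> K" using that shift_K_nat by blast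
    from k(2)[OF this] have "path_component K (z + (real (n * k), 0)) (z + (real (Suc n * k), 0))"
      by (simp add: add.assoc algebra_simps)
    with Suc show ?case by (rule path_component_trans)
  qed
  then show ?thesis using k(1) that by blast
qed

lemma path_far_right:
  assumes "z \<in> K" 
  obtains g :: "real \<Rightarrow> real \<times> real" where "continuous_on {0..1} g" "g ` {0..1} \<subseteq> K" "g 0 = z"
    "\<And>j. j \<le> N \<Longrightarrow> fst ((F ^^ j) u) < fst ((F ^^ j) (g 1))"
proof -
  obtain k where k: "k > 0" "\<And>z n. z \<in> K \<Longrightarrow> path_component K z (z + (real (n * k), 0))"
    using travel_far by blast
  define B where "B = (\<Sum>j\<le>N. \<bar>fst ((F ^^ j) u) - fst ((F ^^ j) z)\<bar>)"
  obtain n :: nat where n: "B < real n" using reals_Archimedean2 by blast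
  obtain g where g: "path g" "path_image g \<subseteq> K" "pathstart g = z" "pathfinish g = z + (real (n * k), 0)"
    using k(2)[OF assms, of n] unfolding path_component_def by blast
  have "fst ((F ^^ j) u) < fst ((F ^^ j) (g 1))" if "j \<le> N" for j
  proof -
    have "(F ^^ j) (g 1) = (F ^^ j) z + (real (n * k), 0)"
      using g(4) unfolding pathfinish_def by (simp only: shift_iter_nat)
    moreover have "\<bar>fst ((F ^^ j) u) - fst ((F ^^ j) z)\<bar> \<le> B"
      unfolding B_def using that by (intro member_le_sum) auto
    moreover have "real n \<le> real (n * k)" using k(1) by (simp only: of_nat_le_iff) simp
    ultimately show ?thesis using n by simp
  qed
  then show ?thesis using g that[of g] by (auto simp: path_def path_image_def pathstart_def)
qed

lemma preimage_iter_K: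
  assumes "c \<in> K"
  obtains c0 where "c0 \<in> K" "(F ^^ n) c0 = c"
proof -
  have "surj (F ^^ n)" by (rule surj_fn[OF bij_is_surj[OF bij]])
  then obtain c0 where c0: "c = (F ^^ n) c0" by (rule surjE)
  show ?thesis by (rule that[of c0]) (use assms inv_iter[of n c0] c0 in simp_all)
qed

text \<open>
  Carry the point \<open>c\<close> along \<open>K\<close> to the far right and read the angles of the iterated pairs back
  to \<open>c\<close>. Since nothing of \<open>K\<close> lies under \<open>u\<close>, the angle at time \<open>0\<close> cannot increase to the upward
  vertical \<open>pi / 2\<close>, and lagging hands this bound on to later times. Likewise the angle at time
  \<open>N\<close> cannot decrease to the upward vertical \<open>- 3 * pi / 2\<close>, and this bound is handed on to
  earlier times.
\<close>

lemma below_iter_angles: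
  assumes u: "u \<in> below" and uN: "(F ^^ N) u \<in> below" and c: "c \<in> K"
  obtains \<theta> :: "nat \<Rightarrow> real" where
    "\<And>i. i \<le> N \<Longrightarrow> angle ((F ^^ i) c) ((F ^^ i) u) (\<theta> i)"
    "\<And>i. i \<le> N \<Longrightarrow> vertical (-2) < \<theta> i" "\<And>i. i \<le> N \<Longrightarrow> \<theta> i < vertical 0"
    "\<And>i. i < N \<Longrightarrow> lags (\<theta> i) (\<theta> (Suc i))"
proof -
  obtain g :: "real \<Rightarrow> real \<times> real" where g: "continuous_on {0..1} g" "g ` {0..1} \<subseteq> K" "g 0 = c"
    "\<And>j. j \<le> N \<Longrightarrow> fst ((F ^^ j) u) < fst ((F ^^ j) (g 1))"
    using path_far_right[OF c] by blast
  define P where "P i \<theta> \<longleftrightarrow> continuous_on {0..1} \<theta> \<and>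
    (\<forall>t\<in>{0..1}. angle ((F ^^ i) (g t)) ((F ^^ i) u) (\<theta> t)) \<and>
    vertical (-2) < \<theta> 1 \<and> \<theta> 1 < vertical (-1)" for i \<theta>
  have "\<exists>\<theta>. P i \<theta>" if "i \<le> N" for i
  proof -
    have "continuous_on {0..1} ((F ^^ i) \<circ> g)"
      by (intro continuous_on_compose g cont_iter)
    moreover have "(F ^^ i) u \<notin> ((F ^^ i) \<circ> g) ` {0..1}"
      using below_not_K[OF u] g(2) by auto
    ultimately show ?thesis using angle_lift_normalized[of "(F ^^ i) \<circ> g" "(F ^^ i) u"] g(4)[OF that]
      unfolding P_def by (metis comp_apply)
  qed
  then obtain \<theta> where \<theta>: "\<And>i. i \<le> N \<Longrightarrow> P i (\<theta> i)" by metis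
  have ang: "angle ((F ^^ i) (g t)) ((F ^^ i) u) (\<theta> i t)" if "i \<le> N" "t \<in> {0..1}" for i t
    using \<theta>[OF that(1)] that(2) unfolding P_def by blast
  have co: "continuous_on {0..1} (\<theta> i)" if "i \<le> N" for i using \<theta>[OF that] unfolding P_def by blast
  have fin: "vertical (-2) < \<theta> i 1" "\<theta> i 1 < vertical (-1)" if "i \<le> N" for i
    using \<theta>[OF that] unfolding P_def by blast+
  have lag: "lags (\<theta> i t) (\<theta> (Suc i) t)" if "Suc i \<le> N" "t \<in> {0..1}" for i t
  proof (rule lags_path[OF co co _ _ _ that(2)])
    show "i \<le> N" "Suc i \<le> N" using that by auto
    have a: "angle ((F ^^ i) (g t)) ((F ^^ i) u) (\<theta> i t)"
      "angle (F ((F ^^ i) (g t))) (F ((F ^^ i) u)) (\<theta> (Suc i) t)" if "t \<in> {0..1}" for t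
      using ang[of i t] ang[of "Suc i" t] that \<open>Suc i \<le> N\<close> by auto
    show "\<theta> (Suc i) t \<noteq> vertical m"
      if "t \<in> {0..1}" "vertical (m - 1) < \<theta> i t" "\<theta> i t < vertical m" for m t
      using vertical_barrier[OF a[OF that(1)]] that by blast
    show False
      if "t \<in> {0..1}" "\<theta> i t = vertical m" "vertical m \<le> \<theta> (Suc i) t" "\<theta> (Suc i) t \<le> vertical (m + 1)" for m t
      using vertical_crossing[OF a[OF that(1)]] that by blast
    show "lags (\<theta> i 1) (\<theta> (Suc i) 1)"
      unfolding lags_def
    proof (intro allI impI)
      fix m assume "\<theta> i 1 \<le> vertical m"
      with fin(1)[of i] that have "vertical (-2) < vertical m" by linarith
      then have "vertical (-1) \<le> vertical m" by simp
      then show "\<theta> (Suc i) 1 < vertical m" using fin(2)[of "Suc i"] that by linarith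
    qed
  qed
  have not_under: "\<theta> i t \<noteq> vertical 0" "\<theta> i t \<noteq> vertical (-2)"
    if "(F ^^ i) u \<in> below" "i \<le> N" "t \<in> {0..1}" for i t
  proof -
    have False if *: "angle ((F ^^ i) (g t)) ((F ^^ i) u) (pi / 2)"
    proof -
      have "(F ^^ i) (g t) \<in> K" using g(2) \<open>t \<in> {0..1}\<close> inv_iter by blast
      then show False using angle_up[OF *] \<open>(F ^^ i) u \<in> below\<close> unfolding below_def by auto
    qed
    moreover have "angle ((F ^^ i) (g t)) ((F ^^ i) u) (\<theta> i t + 2 * pi)"
      using angle_minus_2pi[OF ang[OF that(2,3)], of "-1"] by simp
    ultimately show "\<theta> i t \<noteq> vertical 0" "\<theta> i t \<noteq> vertical (-2)"
      using ang[OF that(2,3)] by (metis vertical_0, metis vertical_minus_2)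
  qed
  have upper: "\<theta> i t < vertical 0" if "i \<le> N" "t \<in> {0..1}" for i t
    using that(1)
  proof (induction i)
    case 0
    show ?case
    proof (rule ccontr)
      assume "\<not> ?thesis"
      then have "\<exists>s. t \<le> s \<and> s \<le> 1 \<and> \<theta> 0 s = vertical 0"
        using fin(2)[of 0] that(2) vertical_less_iff[of "-1" 0]
        by (intro IVT2') (auto intro: continuous_on_subset[OF co[of 0]] simp del: vertical_less_iff)
      then show False using not_under(1)[of 0] u that(2) by auto
    qed
  next
    case (Suc i)
    then show ?case using lag[of i t] that(2) unfolding lags_def by auto
  qed
  have lower: "vertical (-2) < \<theta> (N - i) t" if "i \<le> N" "t \<in> {0..1}" for i t
    using that(1)
  proof (induction i)
    case 0
    show ?case
    proof (rule ccontr)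
      assume "\<not> ?thesis"
      then have "\<exists>s. t \<le> s \<and> s \<le> 1 \<and> \<theta> N s = vertical (-2)"
        using fin(1)[of N] that(2)
        by (intro IVT') (auto intro: continuous_on_subset[OF co[of N]])
      then show False using not_under(2)[of N] uN that(2) by auto
    qed
  next
    case (Suc i)
    then have "Suc (N - Suc i) = N - i" by simp
    then show ?case using Suc lag[of "N - Suc i" t] that(2) unfolding lags_def
      by (metis Suc_leD diff_le_self linorder_not_less order.asym)
  qed
  show ?thesis
  proof (rule that[of "\<lambda>i. \<theta> i 0"])
    show "angle ((F ^^ i) c) ((F ^^ i) u) (\<theta> i 0)" if "i \<le> N" for i
      using ang[OF that, of 0] g(3) by simp
    show "vertical (-2) < \<theta> i 0" if "i \<le> N" for i
      using lower[of "N - i" 0] that by simp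
    show "\<theta> i 0 < vertical 0" if "i \<le> N" for i using upper[OF that, of 0] by simp
    show "lags (\<theta> i 0) (\<theta> (Suc i) 0)" if "i < N" for i using lag[of i 0] that by simp
  qed
qed

text \<open>
  A point of \<open>K\<close> under the \<open>i\<close>-th image would give it an upward angle, but both neighbouring upward
  angles lie outside the bounds of \<open>below_iter_angles\<close>.
\<close>

lemma below_between:
  assumes "u \<in> below" "(F ^^ N) u \<in> below" "i \<le> N"
  shows "(F ^^ i) u \<in> below"
  unfolding below_def
proof (intro CollectI ballI impI, rule ccontr)
  fix c assume c: "c \<in> K" "fst c = fst ((F ^^ i) u)" "\<not> snd ((F ^^ i) u) < snd c"
  have "(F ^^ i) u \<notin> K" using assms(1) below_not_K inv_iter by blast
  then have lt: "snd c < snd ((F ^^ i) u)" using c by (metis linorder_cases prod.expand)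
  obtain c0 where c0: "c0 \<in> K" "(F ^^ i) c0 = c" using preimage_iter_K[OF c(1)] .
  obtain \<theta> :: "nat \<Rightarrow> real" where
    "angle ((F ^^ i) c0) ((F ^^ i) u) (\<theta> i)" "vertical (-2) < \<theta> i" "\<theta> i < vertical 0"
    using below_iter_angles[OF assms(1,2) c0(1)] assms(3) by metis
  then show False using angle_of_upper_point[of c "(F ^^ i) u"] c0 c(2) lt by simp
qed

text \<open>
  By the angle bounds, a point of \<open>below\<close> has a well-defined position to the left or to the right
  of each point of \<open>K\<close>, being under it on the border between the two; the twist moves it only
  towards the left.
\<close>

lemma below_order:
  assumes "z \<in> below" "F z \<in> below" "c \<in> K" "fst z \<le> fst c"
  shows "fst (F z) < fst (F c)"
proof -
  have F1: "(F ^^ 1) z \<in> below" using assms(2) by simp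
  show ?thesis
  proof (rule below_iter_angles[OF assms(1) F1 assms(3)])
    fix \<theta> :: "nat \<Rightarrow> real"
    assume \<theta>: "\<And>i. i \<le> 1 \<Longrightarrow> angle ((F ^^ i) c) ((F ^^ i) z) (\<theta> i)"
      "\<And>i. i \<le> 1 \<Longrightarrow> vertical (-2) < \<theta> i" "\<And>i. i \<le> 1 \<Longrightarrow> \<theta> i < vertical 0"
      "\<And>i. i < 1 \<Longrightarrow> lags (\<theta> i) (\<theta> (Suc i))"
    have a0: "angle c z (\<theta> 0)" using \<theta>(1)[OF zero_le_one] by (simp only: funpow_0)
    have a1: "angle (F c) (F z) (\<theta> 1)" using \<theta>(1)[OF order_refl] by simp
    have l: "lags (\<theta> 0) (\<theta> 1)" using \<theta>(4)[OF zero_less_one] by (simp only: One_nat_def)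
    have "\<theta> 0 \<le> vertical (-1)"
    proof (rule ccontr)
      assume "\<not> ?thesis"
      then have "- (pi / 2) < \<theta> 0" "\<theta> 0 < pi / 2" using \<theta>(3)[OF zero_le_one] by (simp_all add: vertical_def)
      then have "fst c < fst z" using angle_right[OF a0] by simp
      then show False using assms(4) by simp
    qed
    then have "\<theta> 1 < vertical (-1)" using l unfolding lags_def by blast
    then have b: "- (pi / 2) < \<theta> 1 - 2 * pi * real_of_int (- 1) - pi"
      "\<theta> 1 - 2 * pi * real_of_int (- 1) - pi < pi / 2"
      using \<theta>(2)[OF order_refl] by (simp_all add: vertical_def)
    show ?thesis by (rule angle_right[OF angle_flip[OF angle_minus_2pi[OF a1]] b])
  qed
qed

end

context invariant_set
begin

text \<open>
  Travelling within \<open>K\<close> from the far left to the far right crosses each vertical line.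
\<close>

lemma column_meets_K: "\<exists>s. (x, s) \<in> K"
proof -
  obtain z where z: "z \<in> K" using nonempty by blast
  define z' where "z' = z + (real_of_int (\<lfloor>x - fst z\<rfloor>), 0)"
  have "fst z' = fst z + real_of_int \<lfloor>x - fst z\<rfloor>" unfolding z'_def by simp
  then have z': "z' \<in> K" "fst z' \<le> x" using z shift_K_int[of z] unfolding z'_def by (blast, linarith)
  obtain k :: nat where k: "k > 0" "\<And>z n. z \<in> K \<Longrightarrow> path_component K z (z + (real (n * k), 0))"
    using travel_far by blast
  obtain n :: nat where n: "x - fst z' < real n" using reals_Archimedean2 by blast
  have "real n \<le> real (n * k)" using k(1) by (simp only: of_nat_le_iff) simp
  then have nk: "x \<le> fst (z' + (real (n * k), 0))" using n by simp
  obtain g where g: "path g" "path_image g \<subseteq> K" "pathstart g = z'" "pathfinish g = z' + (real (n * k), 0)"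
    using k(2)[OF z'(1), of n] unfolding path_component_def by blast
  have "\<exists>t. 0 \<le> t \<and> t \<le> 1 \<and> fst (g t) = x"
  proof (rule IVT')
    show "continuous_on {0..1} (\<lambda>t. fst (g t))" using g(1) unfolding path_def by (intro continuous_intros)
    show "fst (g 0) \<le> x" using g(3) z'(2) by (simp add: pathstart_def)
    show "x \<le> fst (g 1)" using g(4) nk by (simp only: pathfinish_def)
  qed simp
  then obtain t where "t \<in> {0..1}" "fst (g t) = x" by auto
  then have "(x, snd (g t)) \<in> K" using g(2) unfolding path_image_def by (metis image_subset_iff prod.collapse)
  then show ?thesis by blast
qed

lemma K_height: "c \<in> K \<Longrightarrow> 0 \<le> snd c \<and> snd c \<le> 1"
  using sub_strip unfolding strip_def by (auto simp: mem_Times_iff)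

lemma below_low: "snd z < 0 \<Longrightarrow> z \<in> below"
  unfolding below_def using K_height by fastforce

lemma below_height: "z \<in> below \<Longrightarrow> snd z < 1"
  unfolding below_def using column_meets_K[of "fst z"] K_height by fastforce

lemma below_down: "(x, y) \<in> below \<Longrightarrow> y' \<le> y \<Longrightarrow> (x, y') \<in> below"
  unfolding below_def by fastforce

lemma open_below: "open below"
proof -
  let ?T = "((\<lambda>w. (fst (snd w), fst w)) -` K) \<inter> {w :: real \<times> (real \<times> real). fst w \<le> snd (snd w)}"
  have "closed ?T"
    by (intro closed_Int closed_vimage closed closed_Collect_le continuous_intros)
  then have "closed {z. \<exists>s. s \<in> {0..1} \<and> (s, z) \<in> ?T}"
    by (intro closed_compact_projection) auto
  moreover have "{z. \<exists>s. s \<in> {0..1} \<and> (s, z) \<in> ?T} = - below"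
  proof (rule subset_antisym; rule subsetI)
    fix z assume "z \<in> {z. \<exists>s. s \<in> {0..1} \<and> (s, z) \<in> ?T}"
    then show "z \<in> - below" unfolding below_def by fastforce
  next
    fix z assume "z \<in> - below"
    then obtain c where c: "c \<in> K" "fst c = fst z" "snd c \<le> snd z" unfolding below_def by force
    then have "(fst z, snd c) \<in> K" by (metis prod.collapse)
    then show "z \<in> {z. \<exists>s. s \<in> {0..1} \<and> (s, z) \<in> ?T}" using c K_height[OF c(1)] by auto
  qed
  ultimately show ?thesis by (simp add: closed_def)
qed

text \<open>
  Suppose a point of \<open>K\<close> lies under a point of \<open>N\<close>. Close to it on both sides there are columns
  that are free of \<open>K\<close> up to a height at which \<open>N\<close> passes over that point of \<open>K\<close>. With a
  horizontal segment inside \<open>N\<close> they bound a box around the point of \<open>K\<close> that a path within \<open>K\<close>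
  to the far right cannot leave.
\<close>

lemma open_subset_closure_below:
  assumes N: "open N" "N \<inter> K = {}" "N \<subseteq> closure below"
  shows "N \<subseteq> below"
proof (rule subsetI, rule ccontr)
  fix z assume z: "z \<in> N" "z \<notin> below"
  then obtain c where c: "c \<in> K" "fst c = fst z" "snd c \<le> snd z" unfolding below_def by force
  have "c \<noteq> z" using c z N(2) by auto
  then have cz: "snd c < snd z" using c by (metis order_le_less prod.expand)
  obtain A B where AB: "open A" "open B" "fst z \<in> A" "snd z \<in> B" "A \<times> B \<subseteq> N"
    using open_prod_elim[OF N(1) z(1)] by (metis SigmaE2 prod.collapse)
  obtain d where d: "d > 0" "{fst z - d .. fst z + d} \<subseteq> A"
    using AB(1,3) open_contains_cball by (metis cball_eq_atLeastAtMost)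
  obtain e where e: "e > 0" "{snd z - e .. snd z + e} \<subseteq> B"
    using AB(2,4) open_contains_cball by (metis cball_eq_atLeastAtMost)
  define y where "y = max (snd z - e) ((snd c + snd z) / 2)"
  have y: "snd c < y" "y < snd z" "snd z - e \<le> y" using cz e unfolding y_def by (auto simp: less_max_iff_disj)
  have col: "\<exists>x\<in>{l<..<r}. (x, y) \<in> below" if "fst z - d \<le> l" "l < r" "r \<le> fst z + d" for l r
  proof -
    let ?W = "{l<..<r} \<times> {y<..<snd z}"
    have W: "open ?W" by (intro open_Times) auto
    have w: "((l + r) / 2, (y + snd z) / 2) \<in> ?W" using that y by auto
    moreover have "?W \<subseteq> N" using AB(5) d(2) e(2) that y by force
    ultimately have "((l + r) / 2, (y + snd z) / 2) \<in> closure below" using N(3) by blast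
    then have "?W \<inter> below \<noteq> {}" using W w by (metis disjoint_iff open_Int_closure_eq_empty)
    then obtain w where w: "w \<in> ?W" "w \<in> below" by blast
    then have "(fst w, y) \<in> below" "fst w \<in> {l<..<r}"
      using below_down[of "fst w" "snd w" y] by (simp_all add: mem_Times_iff)
    then show ?thesis by blast
  qed
  obtain x1 where x1: "fst z - d < x1" "x1 < fst z" "(x1, y) \<in> below"
    using col[of "fst z - d" "fst z"] d by auto
  obtain x2 where x2: "fst z < x2" "x2 < fst z + d" "(x2, y) \<in> below"
    using col[of "fst z" "fst z + d"] d by auto
  let ?B = "{x1<..<x2} \<times> {..<y}"
  obtain g :: "real \<Rightarrow> real \<times> real" where g: "continuous_on {0..1} g" "g ` {0..1} \<subseteq> K" "g 0 = c"
    "\<And>j. j \<le> 0 \<Longrightarrow> fst ((F ^^ j) (x2, y)) < fst ((F ^^ j) (g 1))"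
    using path_far_right[OF c(1), of 0 "(x2, y)"] by blast
  have "g ` {0..1} \<inter> frontier ?B \<noteq> {}"
  proof (rule connected_Int_frontier)
    show "connected (g ` {0..1})" using g(1) by (intro connected_continuous_image) auto
    have "c \<in> ?B" using c x1 x2 y by (simp add: mem_Times_iff)
    then show "g ` {0..1} \<inter> ?B \<noteq> {}" using g(3) by force
    have "g 1 \<notin> ?B" using g(4)[of 0] by (auto simp: mem_Times_iff)
    moreover have "g 1 \<in> g ` {0..1}" by simp
    ultimately show "g ` {0..1} - ?B \<noteq> {}" by blast
  qed
  then obtain w where w: "w \<in> K" "w \<in> frontier ?B" using g(2) by blast
  have cl: "closure ?B = {x1..x2} \<times> {..y}" using x1 x2 by (simp add: closure_Times)
  have "open ?B" by (intro open_Times) auto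
  then have "w \<in> {x1..x2} \<times> {..y} - ?B" using w(2) cl by (simp add: frontier_def interior_open)
  then consider "fst w = x1" "snd w \<le> y" | "fst w = x2" "snd w \<le> y" | "fst w \<in> {x1..x2}" "snd w = y"
    by (cases w) fastforce
  then show False
  proof cases
    case 1
    then show False using w(1) x1(3) unfolding below_def by force
  next
    case 2
    then show False using w(1) x2(3) unfolding below_def by force
  next
    case 3
    then have "w \<in> A \<times> B" using x1 x2 d(2) e(2) y by (cases w) auto
    then show False using AB(5) N(2) w(1) by blast
  qed
qed

end

section \<open>Recurrence makes the lower region invariant\<close>

text \<open>
  Recurrence is stated for open sets that are invariant under the deck translation, as these are
  the preimages of open sets of the annulus.
\<close>

locale nonwandering_twist = twist_plane +
  assumes strip_to_strip: "0 \<le> snd z \<and> snd z \<le> 1 \<Longrightarrow> 0 \<le> snd (F z) \<and> snd (F z) \<le> 1"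
    and outside: "snd z < 0 \<or> 1 < snd z \<Longrightarrow> snd (F z) = snd z"
    and recurrent: "open W \<Longrightarrow> (\<And>z. z + (1, 0) \<in> W \<longleftrightarrow> z \<in> W) \<Longrightarrow> W \<inter> strip \<noteq> {} \<Longrightarrow>
      \<exists>z\<in>W \<inter> strip. \<exists>n\<ge>1. (F ^^ n) z \<in> W"
begin

lemma open_image: "open W \<Longrightarrow> open (F ` W)"
  by (rule invariance_of_domain) (auto intro: continuous_on_subset[OF cont] simp: inj_on_def)

end

locale birkhoff = nonwandering_twist F + invariant_set F K for F K
begin

lemma shift_below1: "z + (1, 0) \<in> below \<longleftrightarrow> z \<in> below"
  using shift_below[of z 1] by simp

lemma shift_closure_below: "z + (1, 0) \<in> closure below \<longleftrightarrow> z \<in> closure below"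
proof -
  have "(\<lambda>z. (1, 0) + z) ` below = below"
  proof
    show "(\<lambda>z. (1, 0) + z) ` below \<subseteq> below" using shift_below1 by (auto simp: add.commute[of "(1,0)"])
    show "below \<subseteq> (\<lambda>z. (1, 0) + z) ` below"
    proof
      fix z assume "z \<in> below"
      then have "z + (-1, 0) \<in> below" using shift_below[of z "-1"] by simp
      moreover have "z = (1, 0) + (z + (-1, 0))" by (simp add: prod_eq_iff)
      ultimately show "z \<in> (\<lambda>z. (1, 0) + z) ` below" by blast
    qed
  qed
  then have "closure below = (\<lambda>z. (1, 0) + z) ` closure below" by (metis closure_translation)
  then show ?thesis by (smt (verit, best) add.commute add_left_cancel image_iff)
qed

text \<open>
  A returning orbit in \<open>F ` below - closure below\<close> passes through \<open>below\<close> one step before its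
  start and one step before its return, but not at its start. This contradicts \<open>below_between\<close>.
\<close>

lemma image_below_closure: "F ` below \<subseteq> closure below"
proof (rule ccontr)
  assume not: "\<not> ?thesis"
  let ?W = "F ` below - closure below"
  have "open ?W" by (intro open_Diff open_image open_below) auto
  moreover have "z + (1, 0) \<in> F ` below \<longleftrightarrow> z \<in> F ` below" for z
  proof -
    obtain u where u: "z = F u" using bij by (metis bij_pointE)
    have "z + (1, 0) = F (u + (1, 0))" using u shift by simp
    then show ?thesis using u shift_below1 by (simp add: image_iff)
  qed
  then have "z + (1, 0) \<in> ?W \<longleftrightarrow> z \<in> ?W" for z using shift_closure_below by simp
  moreover have "z \<in> strip" if z: "z \<in> ?W" for z
  proof -
    have "\<not> snd z < 0" using z below_low closure_subset by blast
    moreover obtain u where u: "u \<in> below" "z = F u" using z by blast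
    moreover have "snd z \<le> 1" using below_height[OF u(1)] outside[of u] strip_to_strip[of u] u(2)
      by fastforce
    ultimately show ?thesis unfolding strip_def by (simp add: mem_Times_iff)
  qed
  then have "?W \<inter> strip \<noteq> {}" using not by blast
  ultimately obtain z n where z: "z \<in> ?W" "n \<ge> 1" "(F ^^ n) z \<in> ?W" using recurrent[of ?W] by blast
  then obtain u u' where u: "u \<in> below" "z = F u" "u' \<in> below" "(F ^^ n) z = F u'" by blast
  have "F ((F ^^ n) u) = F u'" using u by (metis funpow_swap1)
  then have "(F ^^ n) u \<in> below" using u by simp
  then have "(F ^^ 1) u \<in> below" using below_between[OF u(1)] z(2) by blast
  then show False using z(1) u(2) closure_subset by auto
qed

text \<open>
  Dually, a returning orbit in \<open>F -` below - closure below\<close> passes through \<open>below\<close> one step after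
  its start and one step after its return, but not at the return itself.
\<close>

lemma vimage_below_closure: "F -` below \<subseteq> closure below"
proof (rule ccontr)
  assume not: "\<not> ?thesis"
  let ?W = "F -` below - closure below"
  have "open ?W" by (intro open_Diff open_vimage open_below cont) auto
  moreover have "z + (1, 0) \<in> ?W \<longleftrightarrow> z \<in> ?W" for z
    using shift_closure_below shift_below1 by (simp add: shift)
  moreover have "z \<in> strip" if z: "z \<in> ?W" for z
  proof -
    have "\<not> snd z < 0" using z below_low closure_subset by blast
    moreover have "snd z \<le> 1" using below_height[of "F z"] outside[of z] z by fastforce
    ultimately show ?thesis unfolding strip_def by (simp add: mem_Times_iff)
  qed
  then have "?W \<inter> strip \<noteq> {}" using not by blast
  ultimately obtain z n where z: "z \<in> ?W" "n \<ge> 1" "(F ^^ n) z \<in> ?W" using recurrent[of ?W] by blast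
  obtain m where m: "n = Suc m" using z(2) by (cases n) auto
  have "(F ^^ Suc m) (F z) = F ((F ^^ n) z)" using m by (simp add: funpow_swap1)
  then have "(F ^^ Suc m) (F z) \<in> below" using z(3) by simp
  then have "(F ^^ m) (F z) \<in> below" using below_between[of "F z" "Suc m" m] z(1) by auto
  then have "(F ^^ n) z \<in> below" using m by (simp add: funpow_swap1)
  then show False using z(3) closure_subset by auto
qed

lemma below_invariant: "F z \<in> below \<longleftrightarrow> z \<in> below"
proof
  have "F -` below \<inter> K = {}" using below_not_K inv by blast
  then have "F -` below \<subseteq> below"
    by (intro open_subset_closure_below vimage_below_closure open_vimage open_below cont)
  then show "F z \<in> below \<Longrightarrow> z \<in> below" by auto
  have "F z \<notin> K" if "z \<in> below" for z using below_not_K[OF that] inv by simp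
  then have "F ` below \<inter> K = {}" by blast
  then have "F ` below \<subseteq> below"
    by (intro open_subset_closure_below image_below_closure open_image open_below)
  then show "z \<in> below \<Longrightarrow> F z \<in> below" by auto
qed

end

section \<open>The lower envelope is an invariant graph\<close>

context birkhoff
begin

definition height :: "real \<Rightarrow> real" where
  "height x = Inf {s. (x, s) \<in> K}"

lemma height_lower: "(x, s) \<in> K \<Longrightarrow> height x \<le> s"
  unfolding height_def using K_height by (intro cInf_lower bdd_belowI[of _ 0]) fastforce+

lemma height_in_K: "(x, height x) \<in> K"
proof -
  have "closed ((\<lambda>s. (x, s)) -` K)" by (intro closed_vimage closed continuous_intros)
  moreover have "(\<lambda>s. (x, s)) -` K = {s. (x, s) \<in> K}" by auto
  ultimately have "Inf {s. (x, s) \<in> K} \<in> {s. (x, s) \<in> K}"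
    using column_meets_K[of x] K_height by (intro closed_contains_Inf bdd_belowI[of _ 0]) fastforce+
  then show ?thesis unfolding height_def by simp
qed

lemma below_iff: "z \<in> below \<longleftrightarrow> snd z < height (fst z)"
  using height_in_K[of "fst z"] height_lower unfolding below_def
  by (smt (verit, best) fst_conv mem_Collect_eq prod.collapse snd_conv)

lemma height_bounds: "0 \<le> height x" "height x \<le> 1"
  using K_height[OF height_in_K[of x]] by auto

lemma height_shift: "height (x + 1) = height x"
  using shift_K[of "(x, s)" for s] unfolding height_def by simp

text \<open>
  This excludes upward jumps of \<open>height\<close> near \<open>x\<close>. Points of \<open>below\<close> at height \<open>y\<close> arbitrarily
  close to the column of \<open>x\<close> would approach a point over \<open>(x, height x)\<close>. From the left, they
  contradict \<open>below_order\<close>, because \<open>F\<close> moves the upper of these two points to the right of the lower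
  one; from the right, they do so one step earlier, because the inverse moves it to the left.
\<close>

lemma height_gate:
  assumes y: "height x < y"
  obtains A where "open A" "x \<in> A" "\<And>x'. x' \<in> A \<Longrightarrow> (x', y) \<notin> below"
proof -
  let ?p = "(x, height x)"
  obtain p where p: "F p = ?p" using bij by (metis bij_pointE)
  obtain w where w: "F w = (x, y)" using bij by (metis bij_pointE)
  have pK: "p \<in> K" using p inv height_in_K by metis
  let ?N1 = "{z. fst (F ?p) < fst (F z)}" and ?N2 = "F ` {v. fst v < fst p}"
  have "open ?N1" by (intro open_Collect_less continuous_intros cont)
  moreover have "open ?N2" by (intro open_image open_Collect_less continuous_intros)
  ultimately have o: "open (?N1 \<inter> ?N2)" by (rule open_Int)
  have "fst w < fst p" using untwist[of p w] p w y by simp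
  then have "(x, y) \<in> ?N2" using w by (metis (mono_tags, lifting) image_eqI mem_Collect_eq)
  moreover have "(x, y) \<in> ?N1" using twist[OF y] by simp
  ultimately have m: "(x, y) \<in> ?N1 \<inter> ?N2" by blast
  obtain A B where AB0: "open A" "open B" "(x, y) \<in> A \<times> B" "A \<times> B \<subseteq> ?N1 \<inter> ?N2"
    using open_prod_elim[OF o m] .
  then have AB: "open A" "x \<in> A" "y \<in> B" "A \<times> B \<subseteq> ?N1 \<inter> ?N2" by auto
  have "(x', y) \<notin> below" if "x' \<in> A" for x'
  proof
    assume b: "(x', y) \<in> below"
    have N: "(x', y) \<in> ?N1" "(x', y) \<in> ?N2" using AB that by blast+
    show False
    proof (cases "x' \<le> x")
      case True
      then show False using below_order[OF b _ height_in_K[of x]] b below_invariant N(1) by fastforce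
    next
      case False
      obtain v where v: "(x', y) = F v" "fst v < fst p" using N(2) by blast
      have Fv: "F v \<in> below" using b v(1) by metis
      then have "fst (F v) < fst (F p)" using below_order[of v p] below_invariant pK v(2) by auto
      then show False using False p v(1) by (metis fst_conv less_imp_le)
    qed
  qed
  then show ?thesis using AB that by blast
qed

lemma continuous_height: "continuous_on A height"
proof -
  have "(height \<longlongrightarrow> height x) (at x)" for x
  proof (rule order_tendstoI)
    fix a assume "a < height x"
    then have "(x, a) \<in> below" by (simp add: below_iff)
    then obtain A B where AB: "open A" "x \<in> A" "a \<in> B" "A \<times> B \<subseteq> below"
      using open_below open_prod_elim by (metis SigmaE2)
    then have "\<forall>x'\<in>A. a < height x'" using below_iff by (metis SigmaI fst_conv snd_conv subsetD)
    then show "eventually (\<lambda>x. a < height x) (at x)"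
      using AB(1,2) unfolding eventually_at_topological by blast
  next
    fix a assume a: "height x < a"
    then have "height x < (height x + a) / 2" by simp
    then obtain A where A: "open A" "x \<in> A" "\<And>x'. x' \<in> A \<Longrightarrow> (x', (height x + a) / 2) \<notin> below"
      using height_gate by blast
    have "height x' < a" if "x' \<in> A" for x'
      using A(3)[OF that] a unfolding below_iff by auto
    then show "eventually (\<lambda>x. height x < a) (at x)"
      using A(1,2) unfolding eventually_at_topological by blast
  qed
  then show ?thesis by (simp add: continuous_at_imp_continuous_on isCont_def)
qed

lemma graph_invariant: "snd (F (x, height x)) = height (fst (F (x, height x)))"
proof (rule antisym)
  let ?T = "{y. snd (F (x, y)) \<le> height (fst (F (x, y)))}"
  have c: "continuous_on UNIV (\<lambda>y. F (x, y))"
    by (rule continuous_on_compose2[OF cont]) (auto intro!: continuous_intros)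
  have "closed ?T"
    by (intro closed_Collect_le continuous_intros c continuous_on_compose2[OF continuous_height[of UNIV]]) auto
  moreover have "{..<height x} \<subseteq> ?T"
  proof
    fix y assume "y \<in> {..<height x}"
    then have "F (x, y) \<in> below" using below_invariant below_iff[of "(x, y)"] by simp
    then show "y \<in> ?T" by (simp add: below_iff)
  qed
  ultimately have "closure {..<height x} \<subseteq> ?T" by (rule closure_minimal[rotated])
  then show "snd (F (x, height x)) \<le> height (fst (F (x, height x)))" by auto
  have "F (x, height x) \<in> K" using height_in_K inv by simp
  then show "height (fst (F (x, height x))) \<le> snd (F (x, height x))" by (intro height_lower) simp
qed

end

section \<open>Rotation numbers on two ordered invariant graphs\<close>

context nonwandering_twist
begin

text \<open>
  Shrink \<open>W\<close> to the points that come back after one fixed return time, and repeat: each round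
  adds a return time.
\<close>

lemma many_returns:
  assumes "open W" "\<And>z. z + (1, 0) \<in> W \<longleftrightarrow> z \<in> W" "W \<inter> strip \<noteq> {}"
  shows "\<exists>z\<in>W \<inter> strip. \<exists>A. finite A \<and> card A = Suc k \<and> (\<forall>t\<in>A. (F ^^ t) z \<in> W)"
  using assms
proof (induction k arbitrary: W)
  case 0
  then obtain z where "z \<in> W \<inter> strip" by blast
  then show ?case by (intro bexI[of _ z] exI[of _ "{0}"]) auto
next
  case (Suc k)
  obtain z0 n where z0: "z0 \<in> W \<inter> strip" "n \<ge> 1" "(F ^^ n) z0 \<in> W"
    using recurrent[OF Suc.prems] by blast
  let ?W = "W \<inter> (F ^^ n) -` W"
  have "open ?W" by (intro open_Int Suc.prems(1) open_vimage cont_iter)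
  moreover have "z + (1, 0) \<in> ?W \<longleftrightarrow> z \<in> ?W" for z
    using shift_iter[of n z 1] Suc.prems(2) by simp
  moreover have "?W \<inter> strip \<noteq> {}" using z0 by blast
  ultimately obtain z A where z: "z \<in> ?W \<inter> strip" and A: "finite A" "card A = Suc k" "\<forall>t\<in>A. (F ^^ t) z \<in> ?W"
    using Suc.IH[of ?W] by blast
  have ne: "A \<noteq> {}" using A(2) by auto
  have "Max A + n \<notin> A" using Max_ge[OF A(1), of "Max A + n"] z0(2) by auto
  moreover have "(F ^^ (Max A + n)) z \<in> W"
  proof -
    have "(F ^^ Max A) z \<in> ?W" using A(3) Max_in[OF A(1) ne] by blast
    then show ?thesis by (simp add: funpow_add add.commute[of "Max A"])
  qed
  ultimately have "finite (insert (Max A + n) A) \<and> card (insert (Max A + n) A) = Suc (Suc k) \<and>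
      (\<forall>t\<in>insert (Max A + n) A. (F ^^ t) z \<in> W)"
    using A by auto
  then show ?case using z by blast
qed

text \<open>
  Among \<open>q + 1\<close> return times two are congruent modulo \<open>q\<close>, and their difference is a return time
  for \<open>F ^^ q\<close>.
\<close>

lemma iterate_recurrent:
  assumes q: "q \<ge> 1" and W: "open W" "\<And>z. z + (1, 0) \<in> W \<longleftrightarrow> z \<in> W" "W \<inter> strip \<noteq> {}"
  shows "\<exists>z\<in>W. \<exists>n\<ge>1. (F ^^ (q * n)) z \<in> W"
proof -
  obtain z A where A: "finite A" "card A = Suc q" "\<forall>t\<in>A. (F ^^ t) z \<in> W"
    using many_returns[OF W, of q] by blast
  have "(\<lambda>t. t mod q) ` A \<subseteq> {..<q}" using q by auto
  then have "card ((\<lambda>t. t mod q) ` A) \<le> card {..<q}" by (intro card_mono) auto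
  then have "\<not> inj_on (\<lambda>t. t mod q) A" using A(2) card_image[of "\<lambda>t. t mod q" A] by auto
  then obtain a b where ab: "a \<in> A" "b \<in> A" "a < b" "a mod q = b mod q"
    unfolding inj_on_def by (metis linorder_neqE_nat)
  then have "q dvd b - a" by (metis less_imp_le mod_eq_dvd_iff_nat)
  then obtain n where n: "b - a = q * n" by blast
  then have "n \<ge> 1" using ab(3) by (cases n) auto
  moreover have "(F ^^ (q * n)) ((F ^^ a) z) = (F ^^ b) z"
  proof -
    have "q * n + a = b" using n ab(3) by simp
    then show ?thesis by (metis funpow_add comp_apply)
  qed
  ultimately show ?thesis using A(3) ab by metis
qed

end

locale invariant_graph = nonwandering_twist F for F +
  fixes \<phi> :: "real \<Rightarrow> real"
  assumes \<phi>_cont: "continuous_on UNIV \<phi>"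
    and \<phi>_per: "\<phi> (x + 1) = \<phi> x"
    and \<phi>_range: "0 \<le> \<phi> x" "\<phi> x \<le> 1"
    and graph: "snd (F (x, \<phi> x)) = \<phi> (fst (F (x, \<phi> x)))"
    and under: "snd (F z) < \<phi> (fst (F z)) \<longleftrightarrow> snd z < \<phi> (fst z)"
begin

definition g :: "real \<Rightarrow> real" where "g x = fst (F (x, \<phi> x))"

lemma F_graph: "F (x, \<phi> x) = (g x, \<phi> (g x))"
  using graph[of x] by (simp add: g_def prod_eq_iff)

lemma F_graph_iter: "(F ^^ n) (x, \<phi> x) = ((g ^^ n) x, \<phi> ((g ^^ n) x))"
  by (induction n) (auto simp: F_graph)

lemma \<phi>_int: "\<phi> (x + real_of_int k) = \<phi> x"
  using periodic_int[of \<phi> x k] \<phi>_per by simp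

lemma g_cont: "continuous_on UNIV g"
proof -
  have "continuous_on UNIV (\<lambda>x. F (x, \<phi> x))"
    by (rule continuous_on_compose2[OF cont]) (auto intro!: continuous_intros \<phi>_cont)
  then show ?thesis unfolding g_def by (intro continuous_intros)
qed

lemma g_shift: "g (x + 1) = g x + 1"
  using shift[of "(x, \<phi> x)"] by (simp add: g_def \<phi>_per)

lemma g_inj: "inj g"
proof (rule injI)
  fix x y assume "g x = g y"
  then have "F (x, \<phi> x) = F (y, \<phi> y)" by (simp add: F_graph)
  then show "x = y" by simp
qed

sublocale circle: circle_lift g
proof
  show "strict_mono g"
  proof (rule strict_monoI)
    fix x y :: real assume xy: "x < y"
    obtain n :: nat where n: "y - x < real n" using reals_Archimedean2 by blast
    have "g (x + real_of_int (int n)) - (x + real_of_int (int n)) = g x - x"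
      using periodic_int[of "\<lambda>x. g x - x" x "int n"] g_shift by simp
    then have *: "g (x + real n) = g x + real n" by simp
    have "g x < g y \<and> g y < g (x + real n) \<or> g (x + real n) < g y \<and> g y < g x"
      using xy n by (intro continuous_inj_imp_mono continuous_on_subset[OF g_cont] inj_on_subset[OF g_inj]) auto
    then show "g x < g y" unfolding * by auto
  qed
qed (use g_cont g_shift in auto)

lemma above_graph: "\<phi> (fst z) \<le> snd z \<Longrightarrow> \<phi> (fst (F z)) \<le> snd (F z)"
  using under[of z] by linarith

lemma strictly_above_graph: "\<phi> (fst z) < snd z \<longleftrightarrow> \<phi> (fst (F z)) < snd (F z)"
proof -
  have "snd z = \<phi> (fst z) \<longleftrightarrow> snd (F z) = \<phi> (fst (F z))"
  proof
    assume "snd z = \<phi> (fst z)"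
    then show "snd (F z) = \<phi> (fst (F z))" using graph[of "fst z"] by (metis prod.collapse)
  next
    assume e: "snd (F z) = \<phi> (fst (F z))"
    obtain x where x: "g x = fst (F z)"
      using degree_one_surj[of g "fst (F z)"] g_cont g_shift by blast
    have "F z = F (x, \<phi> x)" using x e by (simp add: F_graph prod_eq_iff)
    then show "snd z = \<phi> (fst z)" by simp
  qed
  then show ?thesis using under[of z] by linarith
qed

lemma below_or_on_graph: "snd z \<le> \<phi> (fst z) \<Longrightarrow> snd (F z) \<le> \<phi> (fst (F z))"
  using strictly_above_graph[of z] by linarith

lemma g_le_above:
  assumes "\<phi> (fst z) \<le> snd z" "u \<le> fst z"
  shows "g u \<le> fst (F z)" "\<phi> (fst z) < snd z \<Longrightarrow> g u < fst (F z)"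
proof -
  have "g u \<le> g (fst z)" using assms(2) circle.smono by (simp add: strict_mono_less_eq)
  moreover have "g (fst z) < fst (F z)" if "\<phi> (fst z) < snd z"
    using twist[OF that, of "fst z"] by (simp add: g_def)
  moreover have "g (fst z) = fst (F z)" if "\<phi> (fst z) = snd z"
    using that by (simp add: g_def)
  ultimately show "g u \<le> fst (F z)" "\<phi> (fst z) < snd z \<Longrightarrow> g u < fst (F z)"
    using assms(1) by fastforce+
qed

lemma g_ge_below:
  assumes "snd z \<le> \<phi> (fst z)" "fst z \<le> u"
  shows "fst (F z) \<le> g u"
proof -
  have "g (fst z) \<le> g u" using assms(2) circle.smono by (simp add: strict_mono_less_eq)
  moreover have "fst (F z) \<le> g (fst z)"
  proof (cases "snd z = \<phi> (fst z)")
    case True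
    then show ?thesis by (simp add: g_def flip: True)
  next
    case False
    then show ?thesis using twist[of "snd z" "\<phi> (fst z)" "fst z"] assms(1) by (simp add: g_def)
  qed
  ultimately show ?thesis by simp
qed

lemma rotation_on_graph:
  "(\<lambda>n. (fst ((F ^^ n) (x, \<phi> x)) - x) / real n) \<longlonglongrightarrow> circle.rotation"
  using circle.rotation[of x] by (simp add: F_graph_iter)

end

locale ordered_graphs =
  lower: invariant_graph F \<phi> + upper: invariant_graph F \<psi> for F \<phi> \<psi> +
  assumes less: "\<phi> x < \<psi> x"
begin

definition band :: "(real \<times> real) set" where
  "band = {z. \<phi> (fst z) \<le> snd z \<and> snd z \<le> \<psi> (fst z)}"

lemma g_less: "lower.g x < upper.g x"
  using lower.twist[OF less, of x x] by (simp add: lower.g_def upper.g_def)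

lemma g_iter_less:
  assumes "n \<ge> 1"
  shows "(lower.g ^^ n) x < (upper.g ^^ n) x"
  using assms
proof (induction n rule: dec_induct)
  case base
  then show ?case using g_less by simp
next
  case (step n)
  have "(lower.g ^^ Suc n) x < upper.g ((lower.g ^^ n) x)" using g_less by simp
  also have "\<dots> < upper.g ((upper.g ^^ n) x)"
    using step upper.circle.smono by (simp add: strict_mono_less)
  finally show ?case by simp
qed

lemma band_iter:
  assumes "z \<in> band" "a \<le> fst z" "fst z \<le> b"
  shows "(F ^^ n) z \<in> band" "(lower.g ^^ n) a \<le> fst ((F ^^ n) z)" "fst ((F ^^ n) z) \<le> (upper.g ^^ n) b"
proof (induction n)
  case (Suc n)
  { case 1 show ?case using Suc(1) lower.above_graph upper.below_or_on_graph by (simp add: band_def) }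
  { case 2 show ?case using Suc(1,2) lower.g_le_above(1) by (simp add: band_def) }
  { case 3 show ?case using Suc(1,3) upper.g_ge_below by (simp add: band_def) }
qed (use assms in auto)

lemma band_iter_strict:
  assumes "z \<in> band" "a \<le> fst z" "n \<ge> 1" "\<phi> (fst ((F ^^ n) z)) < snd ((F ^^ n) z)"
  shows "(lower.g ^^ n) a < fst ((F ^^ n) z)"
proof -
  obtain k where k: "n = Suc k" using assms(3) by (cases n) auto
  have "\<phi> (fst ((F ^^ k) z)) < snd ((F ^^ k) z)"
    using assms(4) lower.strictly_above_graph[of "(F ^^ k) z"] k by simp
  then show ?thesis
    using lower.g_le_above(2)[of "(F ^^ k) z" "(lower.g ^^ k) a"] band_iter(2)[OF assms(1,2) order_refl, of k] k
    by simp
qed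

lemma band_shift: "z + (real_of_int k, 0) \<in> band \<longleftrightarrow> z \<in> band"
  by (simp add: band_def lower.\<phi>_int upper.\<phi>_int)

lemma band_strip: "band \<subseteq> strip"
proof
  fix z assume "z \<in> band"
  then show "z \<in> strip"
    using lower.\<phi>_range(1)[of "fst z"] upper.\<phi>_range(2)[of "fst z"]
    unfolding band_def strip_def mem_Times_iff mem_Collect_eq atLeastAtMost_iff by (metis UNIV_I order_trans)
qed

text \<open>
  In the argument sketched at the beginning, \<open>D\<close> is the part of the band over \<open>[a, b]\<close>, \<open>G\<close> the
  normalised iterate that maps \<open>D\<close> into itself, and \<open>v\<close> a point on the left side of \<open>D\<close> that is
  not in the image.
\<close>

lemma rotation_different: "lower.circle.rotation \<noteq> upper.circle.rotation"
proof
  assume eq: "lower.circle.rotation = upper.circle.rotation"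
  obtain q m where q: "q \<ge> 1" and rot: "lower.circle.rotation = real_of_int m / real q"
    by (rule equal_rotation_rational[OF lower.circle.circle_lift_axioms upper.circle.circle_lift_axioms g_less eq])
  obtain a where a: "(lower.g ^^ q) a = a + real_of_int m"
    by (rule lower.circle.rational_rotation_periodic[OF q rot])
  obtain b0 where b0: "(upper.g ^^ q) b0 = b0 + real_of_int m"
    by (rule upper.circle.rational_rotation_periodic[OF q rot[unfolded eq]])
  define b where "b = b0 + real_of_int (- \<lfloor>b0 - a\<rfloor>)"
  have b: "(upper.g ^^ q) b = b + real_of_int m"
    unfolding b_def upper.circle.iter_shift b0 by simp
  have "b \<noteq> a" using g_iter_less[OF q, of a] a b by auto
  moreover have "a \<le> b" "b < a + 1" unfolding b_def by (simp_all, linarith+)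
  ultimately have ab: "a < b" "b < a + 1" by auto
  define G where "G z = (F ^^ q) z + (real_of_int (- m), 0)" for z
  define D where "D = {z \<in> band. a \<le> fst z \<and> fst z \<le> b}"
  have G_D: "G z \<in> D" if "z \<in> D" for z
    using that band_iter[of z a b q] band_shift[of "(F ^^ q) z" "- m"] a b
    unfolding D_def G_def by auto
  have "D = ({a..b} \<times> {0..1}) \<inter> ({z. \<phi> (fst z) \<le> snd z} \<inter> {z. snd z \<le> \<psi> (fst z)})"
    using band_strip unfolding D_def band_def strip_def by (auto simp: mem_Times_iff)
  moreover have "closed ({z :: real \<times> real. \<phi> (fst z) \<le> snd z} \<inter> {z. snd z \<le> \<psi> (fst z)})"
    by (intro closed_Int closed_Collect_le continuous_intros
        continuous_on_compose2[OF lower.\<phi>_cont] continuous_on_compose2[OF upper.\<phi>_cont]) auto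
  ultimately have "compact D" by (simp add: compact_Int_closed compact_Times)
  moreover have "continuous_on D G" unfolding G_def by (intro continuous_intros lower.cont_iter)
  ultimately have GD: "closed (G ` D)" by (intro compact_imp_closed compact_continuous_image)
  define v where "v = (a, (\<phi> a + \<psi> a) / 2)"
  have v: "v \<notin> G ` D"
  proof
    assume "v \<in> G ` D"
    then obtain z where z: "z \<in> D" "v = G z" by blast
    have F: "(F ^^ q) z = v + (real_of_int m, 0)" unfolding z(2) G_def by (simp add: add.assoc)
    have "\<phi> (fst ((F ^^ q) z)) < snd ((F ^^ q) z)"
      unfolding F using less[of a] by (simp add: v_def lower.\<phi>_int)
    then have "(lower.g ^^ q) a < fst ((F ^^ q) z)" using band_iter_strict[of z a q] z(1) q unfolding D_def by auto
    then show False unfolding F a by (simp add: v_def)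
  qed
  define E where "E = - (G ` D) \<inter> ({z. \<phi> (fst z) < snd z} \<inter> {z. snd z < \<psi> (fst z)})"
  have E: "open E" unfolding E_def
    by (intro open_Int open_Compl GD open_Collect_less continuous_intros
        continuous_on_compose2[OF lower.\<phi>_cont] continuous_on_compose2[OF upper.\<phi>_cont]) auto
  define W0 where "W0 = E \<inter> {a<..<b} \<times> UNIV"
  have W0: "open W0" unfolding W0_def by (intro open_Int E open_Times) auto
  have "v \<in> E" using v less[of a] unfolding E_def by (simp add: v_def)
  then obtain A B where A: "open A" "open B" "v \<in> A \<times> B" "A \<times> B \<subseteq> E"
    using open_prod_elim[OF E] by blast
  then have "a \<in> A" by (simp add: v_def)
  then obtain e where e: "e > 0" "{a - e .. a + e} \<subseteq> A"
    using A(1) open_contains_cball by (metis cball_eq_atLeastAtMost)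
  \<comment> \<open>move \<open>v\<close> slightly to the right, into the interior of the band\<close>
  define d where "d = min e ((b - a) / 2)"
  have d: "0 < d" "d \<le> e" "d < b - a" using e(1) ab unfolding d_def by (auto simp: min_less_iff_disj)
  then have "a + d \<in> A" using e(2) by auto
  then have "(a + d, snd v) \<in> E" using A(3,4) by (auto simp: mem_Times_iff)
  then have W0_ne: "(a + d, snd v) \<in> W0" using d unfolding W0_def by auto
  define W where "W = (\<Union>j. (\<lambda>z. z + (real_of_int j, 0)) -` W0)"
  have "open W" unfolding W_def by (intro open_UN ballI open_vimage W0 continuous_intros)
  moreover have "z + (1, 0) \<in> W \<longleftrightarrow> z \<in> W" for z
  proof
    assume "z + (1, 0) \<in> W"
    then obtain j where "z + (1, 0) + (real_of_int j, 0) \<in> W0" unfolding W_def by blast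
    moreover have "z + (1, 0) + (real_of_int j, 0) = z + (real_of_int (j + 1), 0)"
      by (simp add: prod_eq_iff)
    ultimately have "z + (real_of_int (j + 1), 0) \<in> W0" by metis
    then show "z \<in> W" unfolding W_def by blast
  next
    assume "z \<in> W"
    then obtain j where "z + (real_of_int j, 0) \<in> W0" unfolding W_def by blast
    then have "z + (1, 0) + (real_of_int (j - 1), 0) \<in> W0" by (simp add: add.assoc)
    then show "z + (1, 0) \<in> W" unfolding W_def by blast
  qed
  moreover have "W \<inter> strip \<noteq> {}"
  proof -
    have "W0 \<subseteq> strip" using band_strip unfolding W0_def E_def band_def by force
    moreover have "W0 \<subseteq> W"
    proof
      fix z assume "z \<in> W0"
      then have "z + (real_of_int 0, 0) \<in> W0" by simp
      then show "z \<in> W" unfolding W_def by blast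
    qed
    ultimately show ?thesis using W0_ne by blast
  qed
  ultimately obtain z n where z: "z \<in> W" "n \<ge> 1" "(F ^^ (q * n)) z \<in> W"
    using lower.iterate_recurrent[OF q, of W] by blast
  obtain i j where i: "z + (real_of_int i, 0) \<in> W0" and j: "(F ^^ (q * n)) z + (real_of_int j, 0) \<in> W0"
    using z unfolding W_def by blast
  define y where "y = z + (real_of_int i, 0)"
  define w where "w k = (F ^^ (q * k)) y + (real_of_int (- int k * m), 0)" for k
  have w_Suc: "w (Suc k) = G (w k)" for k
  proof -
    have "(F ^^ q) (w k) = (F ^^ q) ((F ^^ (q * k)) y) + (real_of_int (- int k * m), 0)"
      unfolding w_def by (rule lower.shift_iter)
    also have "(F ^^ q) ((F ^^ (q * k)) y) = (F ^^ (q * Suc k)) y" by (simp add: funpow_add)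
    finally show ?thesis unfolding G_def w_def by (simp add: prod_eq_iff algebra_simps)
  qed
  have "y \<in> D" using i ab unfolding y_def[symmetric] W0_def E_def D_def band_def
    by (auto simp: mem_Times_iff)
  then have wD: "w k \<in> D" for k
  proof (induction k)
    case 0
    then show ?case by (simp add: w_def)
  next
    case (Suc k)
    then show ?case using G_D w_Suc by simp
  qed
  obtain k where "n = Suc k" using z(2) by (cases n) auto
  then have wn: "w n \<in> G ` D" "w n \<in> D" using w_Suc wD by blast+
  \<comment> \<open>The translates of the open strip over \<open>]a, b[\<close> are disjoint, so no deck translation is left.\<close>
  define J where "J = j - i + int n * m"
  have "(F ^^ (q * n)) y = (F ^^ (q * n)) z + (real_of_int i, 0)" unfolding y_def by (rule lower.shift_iter)
  then have "w n + (real_of_int J, 0) = (F ^^ (q * n)) z + (real_of_int j, 0)"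
    unfolding w_def J_def by (simp add: prod_eq_iff)
  then have wJ: "w n + (real_of_int J, 0) \<in> W0" using j by simp
  then have "a < fst (w n) + real_of_int J" "fst (w n) + real_of_int J < b"
    unfolding W0_def by (auto simp: mem_Times_iff)
  moreover have "a \<le> fst (w n)" "fst (w n) \<le> b" using wn(2) unfolding D_def by auto
  ultimately have "\<bar>real_of_int J\<bar> < 1" using ab by linarith
  then have "J = 0" by linarith
  then show False using wJ wn(1) unfolding W0_def E_def by simp
qed

end

section \<open>From the annulus to the plane\<close>

lemma annulus_cover_eq_iff:
  "annulus_cover z = annulus_cover w \<longleftrightarrow> (\<exists>k. z = w + (real_of_int k, 0))"
proof
  assume "annulus_cover z = annulus_cover w"
  then have s: "snd z = snd w" and "cis (2 * pi * fst z) = cis (2 * pi * fst w)"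
    by (auto simp: annulus_cover_def)
  then have "sin (2 * pi * fst z) = sin (2 * pi * fst w) \<and> cos (2 * pi * fst z) = cos (2 * pi * fst w)"
    by (auto simp: complex_eq_iff)
  then obtain k :: int where "2 * pi * fst z = 2 * pi * fst w + 2 * pi * real_of_int k"
    by (auto simp: sin_cos_eq_iff)
  then have "2 * pi * fst z = 2 * pi * (fst w + real_of_int k)" by (simp add: distrib_left)
  then have "fst z = fst w + real_of_int k" by simp
  then show "\<exists>k. z = w + (real_of_int k, 0)" using s by (intro exI[of _ k]) (simp add: prod_eq_iff)
next
  assume "\<exists>k. z = w + (real_of_int k, 0)"
  then obtain k where k: "z = w + (real_of_int k, 0)" by blast
  have "cis (2 * pi * fst z) = cis (2 * pi * fst w) * cis (2 * pi * real_of_int k)"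
    unfolding k cis_mult by (simp add: distrib_left)
  also have "cis (2 * pi * real_of_int k) = 1" by (simp add: complex_eq_iff)
  finally show "annulus_cover z = annulus_cover w" using k by (simp add: annulus_cover_def)
qed

lemma continuous_annulus_cover: "continuous_on A annulus_cover"
proof -
  have eq: "annulus_cover = (\<lambda>z. (exp (\<i> * complex_of_real (2 * pi * fst z)), snd z))"
    by (auto simp: annulus_cover_def cis_conv_exp fun_eq_iff)
  show ?thesis unfolding eq by (intro continuous_intros)
qed

lemma annulus_cover_in_annulus: "z \<in> strip \<Longrightarrow> annulus_cover z \<in> annulus"
  by (auto simp: annulus_cover_def annulus_def strip_def)

lemma annulus_cover_surj:
  assumes "p \<in> annulus"
  obtains z where "z \<in> strip" "annulus_cover z = p"
proof -
  have n: "cmod (fst p) = 1" using assms by (auto simp: annulus_def mem_Times_iff)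
  then have "fst p \<noteq> 0" by auto
  from cis_Arg[OF this] have "fst p = cis (2 * pi * (Arg (fst p) / (2 * pi)))"
    using n by (simp add: sgn_eq)
  then show ?thesis using assms that[of "(Arg (fst p) / (2 * pi), snd p)"]
    by (auto simp: annulus_cover_def annulus_def strip_def mem_Times_iff prod_eq_iff)
qed

definition clamp01 :: "real \<Rightarrow> real" where "clamp01 y = max 0 (min 1 y)"

text \<open>
  Outside the strip the boundary map is continued along the diagonal, which preserves heights
  and the strict twist. All points under the strip are then under the curve, so that no column is
  without such points, even where the curve touches the boundary of the annulus.
\<close>

definition extend :: "(real \<times> real \<Rightarrow> real \<times> real) \<Rightarrow> real \<times> real \<Rightarrow> real \<times> real" where
  "extend F z = F (fst z, clamp01 (snd z)) + (snd z - clamp01 (snd z), snd z - clamp01 (snd z))"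

lemma strip_iff: "z \<in> strip \<longleftrightarrow> 0 \<le> snd z \<and> snd z \<le> 1"
  by (auto simp: strip_def mem_Times_iff)

lemma extend_strip [simp]: "z \<in> strip \<Longrightarrow> extend F z = F z"
proof -
  assume "z \<in> strip"
  then have "clamp01 (snd z) = snd z" by (simp add: clamp01_def strip_iff)
  then show ?thesis by (simp add: extend_def)
qed

lemma clamp_strip [simp]: "(x, clamp01 y) \<in> strip"
  by (auto simp: clamp01_def strip_iff)

locale annulus_twist =
  fixes f :: "complex \<times> real \<Rightarrow> complex \<times> real" and F :: "real \<times> real \<Rightarrow> real \<times> real"
  assumes twist_f: "twist_map f" and lift: "is_lift F f"
begin

lemma F_cont: "continuous_on strip F" and F_strip: "z \<in> strip \<Longrightarrow> F z \<in> strip"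
  and F_cover: "z \<in> strip \<Longrightarrow> annulus_cover (F z) = f (annulus_cover z)"
  using lift by (auto simp: is_lift_def)

lemma f_inj: "p \<in> annulus \<Longrightarrow> q \<in> annulus \<Longrightarrow> f p = f q \<longleftrightarrow> p = q"
  using twist_f unfolding twist_map_def homeomorphism_def by metis

lemma f_surj: "p \<in> annulus \<Longrightarrow> \<exists>q\<in>annulus. f q = p"
  using twist_f unfolding twist_map_def homeomorphism_def by (metis imageE)

lemma F_differ_int:
  assumes "z \<in> strip" "w \<in> strip"
  shows "(\<exists>k. F z = F w + (real_of_int k, 0)) \<longleftrightarrow> (\<exists>k. z = w + (real_of_int k, 0))"
  unfolding annulus_cover_eq_iff[symmetric] F_cover[OF assms(1)] F_cover[OF assms(2)]
  using f_inj assms annulus_cover_in_annulus by metis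

lemma F_boundary: "z \<in> strip \<Longrightarrow> snd z = 0 \<Longrightarrow> snd (F z) = 0" "z \<in> strip \<Longrightarrow> snd z = 1 \<Longrightarrow> snd (F z) = 1"
proof -
  have s: "snd (annulus_cover z) = snd z" for z by (simp add: annulus_cover_def)
  have "snd (F z) = snd (f (annulus_cover z))" if "z \<in> strip" using F_cover[OF that] s by metis
  then show "z \<in> strip \<Longrightarrow> snd z = 0 \<Longrightarrow> snd (F z) = 0" "z \<in> strip \<Longrightarrow> snd z = 1 \<Longrightarrow> snd (F z) = 1"
    using twist_f annulus_cover_in_annulus[of z] s[of z] unfolding twist_map_def by auto
qed

lemma F_twist: "0 \<le> y \<Longrightarrow> y < y' \<Longrightarrow> y' \<le> 1 \<Longrightarrow> fst (F (x, y)) < fst (F (x, y'))"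
  using twist_f lift unfolding twist_map_def twist_condition_def
  by (auto simp: strict_mono_on_def)

lemma strip_shift: "z + (c, 0) \<in> strip \<longleftrightarrow> z \<in> strip"
  by (simp add: strip_iff)

text \<open>
  The integer depends continuously on the point.
\<close>

lemma degree_exists: "\<exists>d::int. \<forall>z\<in>strip. F (z + (1, 0)) = F z + (real_of_int d, 0)"
proof -
  let ?h = "\<lambda>z. fst (F (z + (1, 0))) - fst (F z)"
  have ex: "\<exists>k::int. F (z + (1, 0)) = F z + (real_of_int k, 0)" if "z \<in> strip" for z
    using F_differ_int[of "z + (1, 0)" z] that strip_shift by (metis of_int_1)
  have "continuous_on strip (\<lambda>z. F (z + (1, 0)))"
    by (rule continuous_on_compose2[OF F_cont]) (auto intro!: continuous_intros simp: strip_iff)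
  then have "continuous_on strip ?h" by (intro continuous_intros F_cont)
  moreover have "connected strip" unfolding strip_def by (intro connected_Times) auto
  moreover have "\<exists>e>0. \<forall>y. y \<in> strip \<and> ?h y \<noteq> ?h x \<longrightarrow> e \<le> norm (?h y - ?h x)" if x: "x \<in> strip" for x
  proof (intro exI[of _ 1] conjI allI impI)
    fix y assume y: "y \<in> strip \<and> ?h y \<noteq> ?h x"
    obtain k l :: int where "?h x = real_of_int k" "?h y = real_of_int l"
      using ex[of x] ex[of y] x y by auto
    moreover from this have "1 \<le> \<bar>l - k\<bar>" using y by auto
    then have "1 \<le> \<bar>real_of_int l - real_of_int k\<bar>" by linarith
    ultimately show "1 \<le> norm (?h y - ?h x)" by simp
  qed simp
  ultimately have "?h constant_on strip" by (intro continuous_discrete_range_constant) auto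
  then obtain c where c: "\<And>z. z \<in> strip \<Longrightarrow> ?h z = c" unfolding constant_on_def by blast
  have "(0, 0) \<in> strip" by (simp add: strip_iff)
  then obtain d :: int where d: "F ((0, 0) + (1, 0)) = F (0, 0) + (real_of_int d, 0)" using ex by blast
  then have "c = real_of_int d" using c[of "(0, 0)"] \<open>(0, 0) \<in> strip\<close> by simp
  then have "F (z + (1, 0)) = F z + (real_of_int d, 0)" if "z \<in> strip" for z
    using ex[OF that] c[OF that] by auto
  then show ?thesis by blast
qed

definition lower_edge :: "real \<Rightarrow> real" where "lower_edge x = fst (F (x, 0))"

lemma F_lower_edge: "F (x, 0) = (lower_edge x, 0)"
  using F_boundary(1)[of "(x, 0)"] by (simp add: lower_edge_def strip_iff prod_eq_iff)

lemma lower_edge_cont: "continuous_on A lower_edge"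
proof -
  have "continuous_on A (\<lambda>x. F (x, 0))"
    by (rule continuous_on_compose2[OF F_cont]) (auto intro!: continuous_intros simp: strip_iff)
  then show ?thesis unfolding lower_edge_def by (intro continuous_intros)
qed

lemma lower_edge_differ_int: "(\<exists>k. lower_edge x = lower_edge y + real_of_int k) \<longleftrightarrow> (\<exists>k. x = y + real_of_int k)"
  using F_differ_int[of "(x, 0)" "(y, 0)"] by (simp add: F_lower_edge strip_iff)

text \<open>
  The restriction to the lower boundary circle is injective. In degree \<open>0\<close> its lift would be an
  injective loop; in degree of absolute value at least \<open>2\<close> some point inside a period would have the
  same image on the circle as its end points.
\<close>

lemma degree_unit:
  assumes d: "\<forall>z\<in>strip. F (z + (1, 0)) = F z + (real_of_int d, 0)"
  shows "d = 1 \<or> d = -1"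
proof -
  have step: "lower_edge (x + 1) = lower_edge x + real_of_int d" for x
    using d[rule_format, of "(x, 0)"] by (simp add: F_lower_edge strip_iff)
  have b1: "lower_edge 1 = lower_edge 0 + real_of_int d" using step[of 0] by simp
  have no: False if "lower_edge x = lower_edge 0 + real_of_int k" "0 < x" "x < 1" for x k
  proof -
    have "\<exists>l. x = 0 + real_of_int l" using lower_edge_differ_int[of x 0] that(1) by blast
    then obtain l where "x = real_of_int l" by auto
    then show False using that by simp
  qed
  have "d \<noteq> 0"
  proof
    assume "d = 0"
    then have "lower_edge 0 = lower_edge 1" using b1 by simp
    then obtain s t where st: "0 \<le> s" "s < t" "t < 1" "lower_edge s = lower_edge t"
      by (rule continuous_loop_not_injective[OF lower_edge_cont])
    then have "lower_edge t = lower_edge s + real_of_int 0" by simp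
    then obtain k where "t = s + real_of_int k" using lower_edge_differ_int by blast
    then show False using st by simp
  qed
  moreover have "\<not> d \<ge> 2"
  proof
    assume "d \<ge> 2"
    then have "\<exists>x\<ge>0. x \<le> 1 \<and> lower_edge x = lower_edge 0 + 1"
      using b1 by (intro IVT' lower_edge_cont) auto
    then obtain x where x: "0 \<le> x" "x \<le> 1" "lower_edge x = lower_edge 0 + 1" by blast
    moreover have "x \<noteq> 0" "x \<noteq> 1" using x(3) b1 \<open>d \<ge> 2\<close> by auto
    ultimately show False using no[of x 1] by simp
  qed
  moreover have "\<not> d \<le> -2"
  proof
    assume "d \<le> -2"
    then have "\<exists>x\<ge>0. x \<le> 1 \<and> lower_edge x = lower_edge 0 - 1"
      using b1 by (intro IVT2' lower_edge_cont) auto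
    then obtain x where x: "0 \<le> x" "x \<le> 1" "lower_edge x = lower_edge 0 - 1" by blast
    moreover have "x \<noteq> 0" "x \<noteq> 1" using x(3) b1 \<open>d \<le> -2\<close> by auto
    ultimately show False using no[of x "-1"] by simp
  qed
  ultimately show ?thesis by linarith
qed

lemma shift_any:
  assumes d: "\<forall>z\<in>strip. F (z + (1, 0)) = F z + (real_of_int d, 0)" and z: "z \<in> strip"
  shows "F (z + (real_of_int k, 0)) = F z + (real_of_int (k * d), 0)"
proof -
  let ?h = "\<lambda>x. F (x, snd z) - (x * real_of_int d, 0)"
  have "?h (x + 1) = ?h x" for x
    using d[rule_format, of "(x, snd z)"] z by (simp add: strip_iff prod_eq_iff algebra_simps)
  then have "?h (fst z + real_of_int k) = ?h (fst z)" using periodic_int[of ?h "fst z" k] by blast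
  moreover have "(fst z + real_of_int k, snd z) = z + (real_of_int k, 0)" by (simp add: prod_eq_iff)
  ultimately have "F (z + (real_of_int k, 0)) - ((fst z + real_of_int k) * real_of_int d, 0) =
      F z - (fst z * real_of_int d, 0)" by (simp only: prod.collapse)
  then show ?thesis by (simp add: prod_eq_iff algebra_simps)
qed

lemma F_inj:
  assumes "z \<in> strip" "w \<in> strip" "F z = F w"
  shows "z = w"
proof -
  obtain d where d: "\<forall>z\<in>strip. F (z + (1, 0)) = F z + (real_of_int d, 0)" using degree_exists by blast
  have "F z = F w + (real_of_int 0, 0)" using assms(3) by simp
  then obtain k where k: "z = w + (real_of_int k, 0)" using F_differ_int[OF assms(1,2)] by blast
  then have "F w = F w + (real_of_int (k * d), 0)" using shift_any[OF d assms(2), of k] assms(3) by simp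
  then have "k * d = 0" by (simp add: prod_eq_iff)
  then have "k = 0" using degree_unit[OF d] by auto
  then show ?thesis using k by simp
qed

lemma lower_edge_inj: "inj lower_edge"
  using F_inj F_lower_edge by (metis Pair_inject injI order_refl snd_conv strip_iff zero_le_one)

lemma lower_edge_monotone:
  assumes d: "\<forall>z\<in>strip. F (z + (1, 0)) = F z + (real_of_int d, 0)" and xy: "x < y"
  shows "d = 1 \<Longrightarrow> lower_edge x < lower_edge y" "d = -1 \<Longrightarrow> lower_edge y < lower_edge x"
proof -
  obtain n :: nat where n: "y - x < real n" using reals_Archimedean2 by blast
  have e: "lower_edge (x + real n) = lower_edge x + real_of_int (int n * d)"
    using shift_any[OF d, of "(x, 0)" "int n"] by (simp add: F_lower_edge strip_iff)
  have "lower_edge x < lower_edge y \<and> lower_edge y < lower_edge (x + real n) \<or> lower_edge (x + real n) < lower_edge y \<and> lower_edge y < lower_edge x"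
    using xy n by (intro continuous_inj_imp_mono lower_edge_cont inj_on_subset[OF lower_edge_inj]) auto
  then show "d = 1 \<Longrightarrow> lower_edge x < lower_edge y" "d = -1 \<Longrightarrow> lower_edge y < lower_edge x" using e by auto
qed

definition upper_edge :: "real \<Rightarrow> real" where "upper_edge x = fst (F (x, 1))"

lemma F_upper_edge: "F (x, 1) = (upper_edge x, 1)"
  using F_boundary(2)[of "(x, 1)"] by (simp add: upper_edge_def strip_iff prod_eq_iff)

lemma upper_edge_inj: "inj upper_edge"
  using F_inj F_upper_edge by (metis Pair_inject injI order_refl snd_conv strip_iff zero_le_one)

lemma upper_edge_cont: "continuous_on A upper_edge"
proof -
  have "continuous_on A (\<lambda>x. F (x, 1))"
    by (rule continuous_on_compose2[OF F_cont]) (auto intro!: continuous_intros simp: strip_iff)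
  then show ?thesis unfolding upper_edge_def by (intro continuous_intros)
qed

lemma extend_low: "snd z \<le> 0 \<Longrightarrow> extend F z = (lower_edge (fst z) + snd z, snd z)"
  by (simp add: extend_def clamp01_def F_lower_edge)

lemma extend_high: "1 \<le> snd z \<Longrightarrow> extend F z = (upper_edge (fst z) + (snd z - 1), snd z)"
  by (simp add: extend_def clamp01_def F_upper_edge)

lemma extend_cont: "continuous_on A (extend F)"
proof -
  have "continuous_on A (\<lambda>z. F (fst z, clamp01 (snd z)))"
    by (rule continuous_on_compose2[OF F_cont]) (auto intro!: continuous_intros simp: clamp01_def strip_iff)
  then show ?thesis unfolding extend_def[abs_def]
    by (intro continuous_intros) (auto intro!: continuous_intros simp: clamp01_def)
qed

lemma extend_twist:
  assumes "y < y'"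
  shows "fst (extend F (x, y)) < fst (extend F (x, y'))"
proof -
  have c: "0 \<le> clamp01 y" "clamp01 y' \<le> 1" "clamp01 y \<le> clamp01 y'" "y - clamp01 y \<le> y' - clamp01 y'"
    using assms by (auto simp: clamp01_def)
  show ?thesis
  proof (cases "clamp01 y = clamp01 y'")
    case True
    then show ?thesis using assms by (simp add: extend_def)
  next
    case False
    then have "fst (F (x, clamp01 y)) < fst (F (x, clamp01 y'))" using c by (intro F_twist) auto
    then show ?thesis using c by (simp add: extend_def)
  qed
qed

lemma extend_snd:
  "snd z < 0 \<Longrightarrow> snd (extend F z) = snd z" "1 < snd z \<Longrightarrow> snd (extend F z) = snd z"
  "z \<in> strip \<Longrightarrow> extend F z \<in> strip"
  using extend_low[of z] extend_high[of z] F_strip[of z] by auto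

lemma extend_inj: "inj (extend F)"
proof (rule injI)
  fix z w assume eq: "extend F z = extend F w"
  consider "snd z < 0" | "1 < snd z" | "z \<in> strip" by (auto simp: strip_iff) linarith
  then show "z = w"
  proof cases
    case 1
    then have "snd w = snd z"
      using extend_snd[of w] extend_snd(1)[of z] eq by (cases "w \<in> strip") (auto simp: strip_iff)
    then show ?thesis using eq 1 extend_low[of z] extend_low[of w] injD[OF lower_edge_inj]
      by (auto simp: prod_eq_iff)
  next
    case 2
    then have "snd w = snd z"
      using extend_snd[of w] extend_snd(2)[of z] eq by (cases "w \<in> strip") (auto simp: strip_iff)
    then show ?thesis using eq 2 extend_high[of z] extend_high[of w] injD[OF upper_edge_inj]
      by (auto simp: prod_eq_iff)
  next
    case 3
    then have "extend F w \<in> strip" using extend_snd(3)[of z] eq by simp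
    then have "w \<in> strip" using extend_snd(1,2)[of w]
      by (cases "snd w < 0"; cases "1 < snd w") (auto simp: strip_iff)
    then show ?thesis using F_inj[OF 3] eq 3 by simp
  qed
qed

lemma column_surj: "\<exists>y. fst (extend F (x, y)) = s"
proof -
  let ?u = "\<lambda>y. fst (extend F (x, y))"
  have c: "continuous_on UNIV ?u"
    by (intro continuous_on_fst continuous_on_compose2[OF extend_cont[of UNIV]]) (auto intro!: continuous_intros)
  define a where "a = min 0 (s - lower_edge x)"
  define b where "b = max 1 (s - upper_edge x + 1)"
  have "?u a \<le> s" using extend_low[of "(x, a)"] by (auto simp: a_def)
  moreover have "s \<le> ?u b" using extend_high[of "(x, b)"] by (auto simp: b_def)
  moreover have "a \<le> b" by (simp add: a_def b_def)
  ultimately have "\<exists>y\<ge>a. y \<le> b \<and> ?u y = s" by (intro IVT' continuous_on_subset[OF c]) auto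
  then show ?thesis by blast
qed

text \<open>
  Vertical lines are mapped to graphs over the whole line, and different graphs are disjoint.
  Hence the order in which they lie is constant along the line. It can be read off at the far left,
  where they are the lines of slope \<open>1\<close> through the images of the boundary points.
\<close>

lemma columns_ordered:
  assumes less: "lower_edge x < lower_edge x'" and eq: "fst (extend F (x, y)) = fst (extend F (x', y'))"
  shows "snd (extend F (x', y')) < snd (extend F (x, y))"
proof -
  define U where "U x s = (THE y. fst (extend F (x, y)) = s)" for x s
  have U: "fst (extend F (x, y)) = s \<longleftrightarrow> y = U x s" for x y s
  proof -
    obtain y0 where y0: "fst (extend F (x, y0)) = s" using column_surj by blast
    have unique: "y = y0" if "fst (extend F (x, y)) = s" for y
      using extend_twist[of y y0 x] extend_twist[of y0 y x] that y0 by linarith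
    then have "U x s = y0" unfolding U_def using y0 by (intro the_equality)
    then show ?thesis using unique y0 by blast
  qed
  have U_cont: "continuous_on UNIV (U x)" for x
  proof -
    let ?u = "\<lambda>y. fst (extend F (x, y))"
    have c: "continuous_on UNIV ?u"
      by (intro continuous_on_fst continuous_on_compose2[OF extend_cont[of UNIV]]) (auto intro!: continuous_intros)
    have "U x (?u y) = y" for y using U[of x y "?u y"] by simp
    then have "continuous_on (?u ` UNIV) (U x)"
      by (intro continuous_on_inverse_open[OF open_UNIV c]) simp_all
    moreover have "?u ` UNIV = UNIV"
    proof -
      have "s \<in> range ?u" for s using column_surj[of x s] by blast
      then show ?thesis by blast
    qed
    ultimately show ?thesis by simp
  qed
  let ?D = "\<lambda>s. snd (extend F (x, U x s)) - snd (extend F (x', U x' s))"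
  have "continuous_on UNIV (\<lambda>s. snd (extend F (x, U x s)))" for x
    by (intro continuous_on_snd continuous_on_compose2[OF extend_cont[of UNIV]])
       (auto intro!: continuous_intros U_cont)
  then have "continuous_on UNIV ?D" by (intro continuous_on_diff) blast+
  moreover have "?D s \<noteq> 0" for s
  proof
    assume "?D s = 0"
    moreover have "fst (extend F (x, U x s)) = s" "fst (extend F (x', U x' s)) = s" using U by blast+
    ultimately have "extend F (x, U x s) = extend F (x', U x' s)" by (simp add: prod_eq_iff)
    then have "x = x'" using injD[OF extend_inj] by blast
    then show False using less by simp
  qed
  ultimately have sign: "(\<forall>s. ?D s > 0) \<or> (\<forall>s. ?D s < 0)" by (rule nonzero_constant_sign)
  \<comment> \<open>so far to the left that both graphs have negative height\<close>
  define s where "s = min (lower_edge x) (lower_edge x')"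
  have low: "U x s = s - lower_edge x" if "s \<le> lower_edge x" for x s
    using U[of x "s - lower_edge x" s] extend_low[of "(x, s - lower_edge x)"] that by simp
  have "?D s > 0"
    using low[of s x] low[of s x'] less extend_low[of "(x, s - lower_edge x)"] extend_low[of "(x', s - lower_edge x')"]
    by (simp add: s_def)
  then have "\<forall>s. ?D s > 0" using sign less_asym by blast
  moreover define s0 where "s0 = fst (extend F (x, y))"
  moreover have "y = U x s0" by (rule U[THEN iffD1]) (simp add: s0_def)
  moreover have "y' = U x' s0" by (rule U[THEN iffD1]) (simp add: s0_def eq)
  ultimately show ?thesis by (metis diff_gt_0_iff_gt)
qed

text \<open>
  The winding number in the definition of an orientation-preserving map excludes degree \<open>- 1\<close>,
  where the image columns are in reversed order. Then points to the right of the centre \<open>?m\<close> are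
  never mapped to points directly under the image of \<open>?m\<close>, and points to the left never to points
  directly over it. Follow the angle of the image along the circle: from \<open>0\<close> to \<open>1/4\<close> and from \<open>3/4\<close>
  to \<open>1\<close> it is trapped between downward verticals, in between it is trapped between upward
  verticals. So it ends lower than it starts, while the winding number \<open>1\<close> demands an increase.
\<close>

lemma lower_edge_not_decreasing:
  assumes dec: "\<And>x y. x < y \<Longrightarrow> lower_edge y < lower_edge x"
  shows False
proof -
  have up: "fst p < fst q" if "fst (F p) = fst (F q)" "snd (F p) < snd (F q)" "p \<in> strip" "q \<in> strip" for p q
  proof (rule ccontr)
    assume "\<not> ?thesis"
    then consider "fst p = fst q" | "fst q < fst p" by linarith
    then show False
    proof cases
      case 1
      have "snd p = snd q" using extend_twist[of "snd p" "snd q" "fst p"] extend_twist[of "snd q" "snd p" "fst p"]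
        that 1 by (metis extend_strip less_irrefl linorder_neqE prod.collapse)
      then show False using 1 that(2) by (metis less_irrefl prod.expand)
    next
      case 2
      then have "lower_edge (fst p) < lower_edge (fst q)" by (rule dec)
      then show False using columns_ordered[of "fst p" "fst q" "snd p" "snd q"] that by simp
    qed
  qed
  define c where "c = (\<lambda>p :: real \<times> real. Complex (fst p) (snd p))"
  define circ where "circ t = (0 + 1/4 * cos (2 * pi * t), 1/2 + 1/4 * sin (2 * pi * t))" for t :: real
  let ?m = "(0, 1/2) :: real \<times> real"
  let ?p = "\<lambda>t. c (F (circ t))"
  have m: "?m \<in> strip" by (simp add: strip_iff)
  have circ_strip: "circ t \<in> strip" for t
    using sin_le_one[of "2 * pi * t"] sin_ge_minus_one[of "2 * pi * t"]
    unfolding circ_def strip_iff snd_conv by linarith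
  have "orientation_preserving f" using twist_f by (simp add: twist_map_def)
  from this[unfolded orientation_preserving_def, rule_format, OF lift, of "1/4" "1/2" 0]
  have wn: "winding_number ?p (c (F ?m)) = 1" by (simp add: c_def circ_def)
  have Fc: "continuous_on A (\<lambda>t. F (circ t))" for A
    by (rule continuous_on_compose2[OF F_cont]) (use circ_strip in \<open>auto intro!: continuous_intros simp: circ_def\<close>)
  have path: "path ?p" unfolding path_def c_def Complex_eq by (intro continuous_intros Fc)
  have ne: "F (circ t) \<noteq> F ?m" for t
  proof
    assume "F (circ t) = F ?m"
    then have "circ t = ?m" using F_inj circ_strip m by blast
    then have "cos (2 * pi * t) = 0" "sin (2 * pi * t) = 0" by (auto simp: circ_def)
    then show False using sin_cos_squared_add[of "2 * pi * t"] by simp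
  qed
  have "c (F ?m) \<notin> path_image ?p"
  proof -
    have "c p = c p' \<longleftrightarrow> p = p'" for p p' by (auto simp: c_def prod_eq_iff)
    then have "c (F ?m) \<noteq> ?p t" for t using ne[of t] by metis
    then show ?thesis unfolding path_image_def by blast
  qed
  then obtain q where q: "path q" "pathfinish q - pathstart q = 2 * of_real pi * \<i> * winding_number ?p (c (F ?m))"
    "\<And>t. t \<in> {0..1} \<Longrightarrow> ?p t = c (F ?m) + exp (q t)"
    using winding_number_as_continuous_log[OF path] by metis
  have turn: "Im (q 1) - Im (q 0) = 2 * pi"
    using arg_cong[OF q(2), of Im] wn by (simp add: pathfinish_def pathstart_def)
  have ang: "angle (F ?m) (F (circ t)) (Im (q t))" if "t \<in> {0..1}" for t
  proof -
    have e: "?p t - c (F ?m) = exp (q t)" using q(3)[OF that] by simp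
    show ?thesis unfolding angle_def
      using arg_cong[OF e, of Re] arg_cong[OF e, of Im]
      by (intro exI[of _ "exp (Re (q t))"]) (auto simp: c_def Re_exp Im_exp)
  qed
  have circ14: "circ (1/4) = (0, 3/4)" by (simp add: circ_def)
  have circ34: "circ (3/4) = (0, 1/4)"
  proof -
    have "2 * pi * (3/4) = pi + pi / 2" by simp
    then show ?thesis unfolding circ_def by (simp only: cos_add sin_add) simp
  qed
  have top_right: "fst (F ?m) < fst (F (circ (1/4)))" unfolding circ14 by (rule F_twist) auto
  have bot_left: "fst (F (circ (3/4))) < fst (F ?m)" unfolding circ34 by (rule F_twist) auto
  \<comment> \<open>normalise the angle at the top of the circle, whose image lies to the right of the centre\<close>
  define k where "k = \<lfloor>(Im (q (1/4)) + pi / 2) / (2 * pi)\<rfloor>"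
  define \<theta> where "\<theta> t = Im (q t) - 2 * pi * real_of_int k" for t
  have \<theta>: "angle (F ?m) (F (circ t)) (\<theta> t)" if "t \<in> {0..1}" for t
    unfolding \<theta>_def by (rule angle_minus_2pi[OF ang[OF that]])
  have \<theta>_cont: "continuous_on {0..1} \<theta>" unfolding \<theta>_def
    using q(1) unfolding path_def by (intro continuous_intros)
  have "real_of_int k \<le> (Im (q (1/4)) + pi / 2) / (2 * pi)" "(Im (q (1/4)) + pi / 2) / (2 * pi) < real_of_int k + 1"
    unfolding k_def by linarith+
  then have "- (pi / 2) \<le> \<theta> (1/4)" "\<theta> (1/4) \<le> 3 * pi / 2"
    unfolding \<theta>_def by (auto simp: field_simps)
  moreover have "angle (F (circ (1/4))) (F ?m) (\<theta> (1/4) - pi)" by (rule angle_flip[OF \<theta>]) simp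
  ultimately have A: "- (pi / 2) < \<theta> (1/4)" "\<theta> (1/4) < pi / 2"
    using angle_of_left_point[of "F (circ (1/4))" "F ?m" "\<theta> (1/4) - pi"] top_right
    by (auto simp: vertical_def)
  have not_up: "\<theta> t \<noteq> pi / 2" if "t \<in> {0..1}" "fst (circ t) \<le> 0" for t
  proof
    assume "\<theta> t = pi / 2"
    then have "angle (F ?m) (F (circ t)) (pi / 2)" using \<theta>[OF that(1)] by metis
    from angle_up[OF this] have "0 < fst (circ t)" using up[of ?m "circ t"] m circ_strip by simp
    then show False using that(2) by simp
  qed
  have not_down: "\<theta> t \<noteq> - (pi / 2)" if "t \<in> {0..1}" "0 \<le> fst (circ t)" for t
  proof
    assume "\<theta> t = - (pi / 2)"
    then have "angle (F ?m) (F (circ t)) (- (pi / 2))" using \<theta>[OF that(1)] by metis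
    from angle_minus_2pi[OF angle_flip[OF this], of "-1"]
    have "angle (F (circ t)) (F ?m) (pi / 2)" by simp
    from angle_up[OF this] have "fst (circ t) < 0" using up[of "circ t" ?m] m circ_strip by simp
    then show False using that(2) by simp
  qed
  have quarter: "0 \<le> cos (2 * pi * s)" if "\<bar>s\<bar> \<le> 1/4" for s :: real
  proof -
    have "\<bar>2 * pi * s\<bar> = 2 * pi * \<bar>s\<bar>" by (simp add: abs_mult)
    also have "\<dots> \<le> 2 * pi * (1/4)" using that by (intro mult_left_mono) auto
    finally have "\<bar>2 * pi * s\<bar> \<le> pi / 2" by simp
    then show ?thesis by (intro cos_ge_zero) linarith+
  qed
  have right1: "0 \<le> fst (circ t)" if "0 \<le> t" "t \<le> 1/4" for t
  proof -
    have "0 \<le> cos (2 * pi * t)" by (rule quarter) (use that in linarith)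
    then show ?thesis by (simp add: circ_def)
  qed
  have right2: "0 \<le> fst (circ t)" if "3/4 \<le> t" "t \<le> 1" for t
  proof -
    have "0 \<le> cos (2 * pi * (1 - t))" by (rule quarter) (use that in linarith)
    also have "\<dots> = cos (2 * pi - 2 * pi * t)" by (simp add: right_diff_distrib)
    finally show ?thesis by (simp add: circ_def cos_diff)
  qed
  have left: "fst (circ t) \<le> 0" if "1/4 \<le> t" "t \<le> 3/4" for t
  proof -
    have "0 \<le> cos (2 * pi * (t - 1/2))" by (rule quarter) (use that in linarith)
    also have "\<dots> = cos (2 * pi * t - pi)" by (simp add: right_diff_distrib)
    finally show ?thesis by (simp add: circ_def cos_diff)
  qed
  have start: "- (pi / 2) < \<theta> 0"
  proof (rule ccontr)
    assume "\<not> ?thesis"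
    then have "\<exists>t\<ge>0. t \<le> 1/4 \<and> \<theta> t = - (pi / 2)"
      using A(1) by (intro IVT' continuous_on_subset[OF \<theta>_cont]) auto
    then show False using not_down right1 by force
  qed
  have "\<theta> (3/4) < pi / 2"
  proof (rule ccontr)
    assume "\<not> ?thesis"
    then have "\<exists>t\<ge>1/4. t \<le> 3/4 \<and> \<theta> t = pi / 2"
      using A(2) by (intro IVT' continuous_on_subset[OF \<theta>_cont]) auto
    then show False using not_up left by force
  qed
  moreover have "\<not> (- (pi / 2) < \<theta> (3/4) \<and> \<theta> (3/4) < pi / 2)"
    using angle_right[OF \<theta>[of "3/4"]] bot_left by auto
  moreover have "\<theta> (3/4) \<noteq> - (pi / 2)" using not_down[of "3/4"] right2[of "3/4"] by simp
  ultimately have B: "\<theta> (3/4) < - (pi / 2)" by linarith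
  have "\<theta> 1 < - (pi / 2)"
  proof (rule ccontr)
    assume "\<not> ?thesis"
    then have "\<exists>t\<ge>3/4. t \<le> 1 \<and> \<theta> t = - (pi / 2)"
      using B by (intro IVT' continuous_on_subset[OF \<theta>_cont]) auto
    then show False using not_down right2 by force
  qed
  then have "\<theta> 1 < \<theta> 0" using start by simp
  then show False using turn pi_gt_zero unfolding \<theta>_def by linarith
qed

lemma F_shift: "z \<in> strip \<Longrightarrow> F (z + (1, 0)) = F z + (1, 0)"
proof -
  obtain d where d: "\<forall>z\<in>strip. F (z + (1, 0)) = F z + (real_of_int d, 0)" using degree_exists by blast
  have "d \<noteq> -1" using lower_edge_not_decreasing lower_edge_monotone(2)[OF d] by blast
  then have "d = 1" using degree_unit[OF d] by blast
  then show "z \<in> strip \<Longrightarrow> ?thesis" using d by simp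
qed

lemma lower_edge_mono: "x < y \<Longrightarrow> lower_edge x < lower_edge y"
  using lower_edge_monotone(1)[of 1] F_shift by simp

end

context annulus_twist
begin

lemma iter_lift:
  assumes "z \<in> strip"
  shows "(F ^^ n) z \<in> strip" "annulus_cover ((F ^^ n) z) = (f ^^ n) (annulus_cover z)"
    "(extend F ^^ n) z = (F ^^ n) z"
  using assms by (induction n) (auto simp: F_strip F_cover)

lemma extend_shift: "extend F (z + (1, 0)) = extend F z + (1, 0)"
proof -
  let ?w = "(fst z, clamp01 (snd z))"
  have "F (?w + (1, 0)) = F ?w + (1, 0)" by (rule F_shift) simp
  then show ?thesis by (simp add: extend_def prod_eq_iff)
qed

lemma extend_surj: "surj (extend F)"
proof -
  have "lower_edge (x + 1) = lower_edge x + 1" "upper_edge (x + 1) = upper_edge x + 1" for x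
    using F_shift[of "(x, 0)"] F_shift[of "(x, 1)"] by (auto simp: lower_edge_def upper_edge_def strip_iff)
  then have surj: "\<exists>x. lower_edge x = s" "\<exists>x. upper_edge x = s" for s
    by (intro degree_one_surj lower_edge_cont upper_edge_cont; simp)+
  have "\<exists>z. extend F z = w" for w
  proof -
    consider "snd w \<le> 0" | "1 \<le> snd w" | "w \<in> strip" by (auto simp: strip_iff) linarith
    then show ?thesis
    proof cases
      case 1
      obtain x where "lower_edge x = fst w - snd w" using surj(1) by blast
      then have "extend F (x, snd w) = w" using 1 extend_low[of "(x, snd w)"] by (simp add: prod_eq_iff)
      then show ?thesis by blast
    next
      case 2
      obtain x where "upper_edge x = fst w - (snd w - 1)" using surj(2) by blast
      then have "extend F (x, snd w) = w" using 2 extend_high[of "(x, snd w)"] by (simp add: prod_eq_iff)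
      then show ?thesis by blast
    next
      case 3
      obtain p where p: "p \<in> annulus" "f p = annulus_cover w"
        using f_surj[OF annulus_cover_in_annulus[OF 3]] by blast
      obtain u where u: "u \<in> strip" "annulus_cover u = p" by (rule annulus_cover_surj[OF p(1)])
      have "annulus_cover w = annulus_cover (F u)" using F_cover[OF u(1)] u(2) p(2) by simp
      then obtain k where k: "w = F u + (real_of_int k, 0)" unfolding annulus_cover_eq_iff by blast
      have "F (u + (real_of_int k, 0)) = F u + (real_of_int (k * 1), 0)"
        by (rule shift_any[OF _ u(1)]) (use F_shift in simp)
      then have "F (u + (real_of_int k, 0)) = w" using k by simp
      moreover have "u + (real_of_int k, 0) \<in> strip" using u(1) by (simp add: strip_iff)
      ultimately have "extend F (u + (real_of_int k, 0)) = w" by simp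
      then show ?thesis by blast
    qed
  qed
  then show ?thesis unfolding surj_def by metis
qed

text \<open>
  Twist and order of the image columns together: directly over an image point lie only images
  of points further to the left.
\<close>

lemma extend_untwist:
  assumes "fst (extend F p) = fst (extend F q)" "snd (extend F p) < snd (extend F q)"
  shows "fst q < fst p"
proof (rule ccontr)
  assume "\<not> ?thesis"
  then consider "fst p = fst q" | "fst p < fst q" by linarith
  then show False
  proof cases
    case 1
    then have q: "(fst p, snd q) = q" by (simp add: prod_eq_iff)
    have "snd p = snd q"
      using extend_twist[of "snd p" "snd q" "fst p"] extend_twist[of "snd q" "snd p" "fst p"] assms(1)
      unfolding q prod.collapse by linarith
    then have "p = q" using q by (simp add: prod_eq_iff)
    then show False using assms(2) by simp
  next
    case 2
    then show False using columns_ordered[OF lower_edge_mono[OF 2], of "snd p" "snd q"] assms by simp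
  qed
qed

text \<open>
  An open set invariant under the deck translation is the preimage of a relatively open subset of
  the annulus: the complement of the image of a compact fundamental domain minus the set.
\<close>

lemma extend_recurrent:
  assumes nw: "non_wandering f" and W: "open W" "\<And>z. z + (1, 0) \<in> W \<longleftrightarrow> z \<in> W" "W \<inter> strip \<noteq> {}"
  shows "\<exists>z\<in>W \<inter> strip. \<exists>n\<ge>1. (extend F ^^ n) z \<in> W"
proof -
  have W_int: "z + (real_of_int k, 0) \<in> W \<longleftrightarrow> z \<in> W" for z k
  proof -
    have per: "((x + 1, snd z) \<in> W) = ((x, snd z) \<in> W)" for x using W(2)[of "(x, snd z)"] by simp
    have "((fst z + real_of_int k, snd z) \<in> W) = ((fst z, snd z) \<in> W)"
      by (rule periodic_int[of "\<lambda>x. (x, snd z) \<in> W", OF per])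
    moreover have "(fst z + real_of_int k, snd z) = z + (real_of_int k, 0)" by (simp add: prod_eq_iff)
    ultimately show ?thesis by (simp only: prod.collapse)
  qed
  define U where "U = annulus_cover ` (W \<inter> strip)"
  let ?Q = "({0..1} \<times> {0..1}) - W"
  have Q: "compact (annulus_cover ` ?Q)"
    by (intro compact_continuous_image continuous_annulus_cover compact_diff compact_Times W(1)) auto
  have "U = annulus \<inter> - (annulus_cover ` ?Q)"
  proof (rule subset_antisym; rule subsetI)
    fix p assume "p \<in> U"
    then obtain z where z: "z \<in> W" "z \<in> strip" "p = annulus_cover z" unfolding U_def by blast
    have pQ: "p \<notin> annulus_cover ` ?Q"
    proof
      assume "p \<in> annulus_cover ` ?Q"
      then obtain w where "p = annulus_cover w" "w \<in> ?Q" by (rule imageE)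
      then have w: "w \<notin> W" "annulus_cover z = annulus_cover w" using z(3) by simp_all
      then obtain k where "z = w + (real_of_int k, 0)" unfolding annulus_cover_eq_iff by blast
      then show False using W_int[of w k] w(1) z(1) by blast
    qed
    have "p \<in> annulus" unfolding z(3) by (rule annulus_cover_in_annulus[OF z(2)])
    then show "p \<in> annulus \<inter> - (annulus_cover ` ?Q)" using pQ by simp
  next
    fix p assume p: "p \<in> annulus \<inter> - (annulus_cover ` ?Q)"
    then have pA: "p \<in> annulus" and pQ: "p \<notin> annulus_cover ` ?Q" by simp_all
    obtain z where z: "z \<in> strip" "annulus_cover z = p" using annulus_cover_surj[OF pA] .
    define w where "w = z + (real_of_int (- \<lfloor>fst z\<rfloor>), 0)"
    have w: "w \<in> {0..1} \<times> {0..1}"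
    proof -
      have "w = (frac (fst z), snd z)" by (simp add: w_def frac_def prod_eq_iff)
      then show ?thesis using z(1) frac_lt_1[of "fst z"] by (simp add: strip_iff less_imp_le)
    qed
    have "annulus_cover w = p" using z(2) annulus_cover_eq_iff[of w z] unfolding w_def by blast
    moreover have "w \<in> W"
    proof (rule ccontr)
      assume "w \<notin> W"
      then have "w \<in> ?Q" using w by (rule DiffI[rotated])
      then have "annulus_cover w \<in> annulus_cover ` ?Q" by (rule imageI)
      with pQ calculation show False by simp
    qed
    moreover have "w \<in> strip" using w by (auto simp: strip_iff)
    ultimately show "p \<in> U" unfolding U_def by blast
  qed
  then have "openin (top_of_set annulus) U"
    using Q by (simp add: openin_open_Int open_Compl compact_imp_closed)
  moreover obtain z0 where z0: "z0 \<in> W" "z0 \<in> strip" using W(3) by blast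
  then have "annulus_cover z0 \<in> U" "annulus_cover z0 \<in> annulus"
    unfolding U_def using annulus_cover_in_annulus by auto
  ultimately obtain n where n: "n \<ge> 1" "(f ^^ n) ` U \<inter> U \<noteq> {}"
    using nw unfolding non_wandering_def wandering_def by blast
  then obtain z w where z: "z \<in> W" "z \<in> strip" and w: "w \<in> W" "w \<in> strip"
    and eq: "(f ^^ n) (annulus_cover z) = annulus_cover w" unfolding U_def by blast
  have "annulus_cover ((F ^^ n) z) = annulus_cover w" using iter_lift[OF z(2)] eq by simp
  then obtain k where "(F ^^ n) z = w + (real_of_int k, 0)" unfolding annulus_cover_eq_iff by blast
  then have "(F ^^ n) z \<in> W" using W_int[of w k] w(1) by simp
  then have "(extend F ^^ n) z \<in> W" using iter_lift(3)[OF z(2)] by simp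
  then show ?thesis using z n(1) by blast
qed

lemma nonwandering_twist_extend:
  assumes "non_wandering f"
  shows "nonwandering_twist (extend F)"
proof
  show "bij (extend F)" using extend_inj extend_surj by (simp add: bij_def)
  show "0 \<le> snd (extend F z) \<and> snd (extend F z) \<le> 1" if "0 \<le> snd z \<and> snd z \<le> 1" for z
    using extend_snd(3)[of z] that by (simp only: strip_iff)
  show "snd (extend F z) = snd z" if "snd z < 0 \<or> 1 < snd z" for z using that extend_snd(1,2) by blast
  show "\<exists>z\<in>W \<inter> strip. \<exists>n\<ge>1. (extend F ^^ n) z \<in> W"
    if "open W" "\<And>z. z + (1, 0) \<in> W \<longleftrightarrow> z \<in> W" "W \<inter> strip \<noteq> {}" for W
    by (rule extend_recurrent[OF assms that])
  show "continuous_on UNIV (extend F)" by (rule extend_cont)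
  show "extend F (z + (1, 0)) = extend F z + (1, 0)" for z by (rule extend_shift)
  show "fst (extend F (x, y)) < fst (extend F (x, y'))" if "y < y'" for x y y' using that by (rule extend_twist)
  show "fst q < fst p" if "fst (extend F p) = fst (extend F q)" "snd (extend F p) < snd (extend F q)" for p q
    using that by (rule extend_untwist)
qed

end

section \<open>Invariant curves of the annulus\<close>

lemma lift_annulus_path:
  assumes g: "path \<gamma>" "path_image \<gamma> \<subseteq> annulus"
  obtains h where "path h" "path_image h \<subseteq> strip" "\<And>t. t \<in> {0..1} \<Longrightarrow> annulus_cover (h t) = \<gamma> t"
proof -
  have mem: "\<gamma> t \<in> annulus" if "t \<in> {0..1}" for t using g(2) that unfolding path_image_def by blast
  have unit: "cmod (fst (\<gamma> t)) = 1" if "t \<in> {0..1}" for t using mem[OF that] by (auto simp: annulus_def)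
  have gc: "continuous_on {0..1} \<gamma>" using g(1) by (simp add: path_def)
  have c: "continuous_on {0..1} (\<lambda>t. fst (\<gamma> t))" by (intro continuous_intros gc)
  have nz: "fst (\<gamma> t) \<noteq> 0" if "t \<in> {0..1}" for t using unit[OF that] by auto
  have contr: "contractible {0..1::real}" by (intro convex_imp_contractible) auto
  obtain q where q: "continuous_on {0..1} q" "\<And>t. t \<in> {0..1} \<Longrightarrow> fst (\<gamma> t) = exp (q t)"
  proof (rule continuous_logarithm_on_contractible[OF c contr nz])
    fix q assume a: "continuous_on {0..1} q" and b: "\<And>t. t \<in> {0..1} \<Longrightarrow> fst (\<gamma> t) = exp (q t)"
    show thesis by (rule that[OF a b])
  qed
  define h where "h t = (Im (q t) / (2 * pi), snd (\<gamma> t))" for t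
  have "path h" unfolding path_def h_def by (intro continuous_intros q(1) gc) auto
  moreover have "annulus_cover (h t) = \<gamma> t" if t: "t \<in> {0..1}" for t
  proof -
    have "Re (q t) = 0" using unit[OF t] q(2)[OF t] by (simp add: norm_exp_eq_Re)
    then have "fst (\<gamma> t) = cis (Im (q t))" using q(2)[OF t] by (simp add: exp_eq_polar)
    then show ?thesis by (simp add: annulus_cover_def h_def prod_eq_iff)
  qed
  moreover have "path_image h \<subseteq> strip"
  proof -
    have "snd (\<gamma> t) \<in> {0..1}" if "t \<in> {0..1}" for t
      using mem[OF that] by (simp add: annulus_def mem_Times_iff)
    then show ?thesis unfolding path_image_def h_def by (auto simp: strip_iff)
  qed
  ultimately show ?thesis using that by blast
qed

text \<open>
  A closed lift could be contracted in the convex strip.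
\<close>

lemma essential_lift_not_closed:
  assumes h: "path h" "path_image h \<subseteq> strip" "\<And>t. t \<in> {0..1} \<Longrightarrow> annulus_cover (h t) = \<gamma> t"
    and \<gamma>: "path \<gamma>" "pathfinish \<gamma> = pathstart \<gamma>" "path_image \<gamma> \<subseteq> annulus"
    and ess: "\<not> (\<exists>a. homotopic_loops annulus \<gamma> (linepath a a))"
  shows "h 0 \<noteq> h 1"
proof
  assume loop: "h 0 = h 1"
  have cs: "convex strip" unfolding strip_def by (intro convex_Times) auto
  let ?a = "h 0"
  have "homotopic_loops strip h (linepath ?a ?a)"
  proof (rule homotopic_loops_linear)
    show "pathfinish h = pathstart h" using loop by (simp add: pathfinish_def pathstart_def)
    fix t :: real assume "t \<in> {0..1}"
    then have "h t \<in> strip" "?a \<in> strip" using h(2) unfolding path_image_def by auto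
    then show "closed_segment (h t) (linepath ?a ?a t) \<subseteq> strip"
      using cs by (simp add: closed_segment_subset linepath_refl)
  qed (use h in auto)
  then have "homotopic_loops annulus (annulus_cover \<circ> h) (annulus_cover \<circ> linepath ?a ?a)"
    by (rule homotopic_loops_continuous_image) (use continuous_annulus_cover annulus_cover_in_annulus in auto)
  moreover have "annulus_cover \<circ> linepath ?a ?a = linepath (annulus_cover ?a) (annulus_cover ?a)"
    by (auto simp: linepath_refl fun_eq_iff)
  moreover have "homotopic_loops annulus \<gamma> (annulus_cover \<circ> h)"
    using \<gamma> h(3) by (intro homotopic_loops_eq) auto
  ultimately show False using ess homotopic_loops_trans by metis
qed

context annulus_twist
begin

definition lifted :: "(complex \<times> real) set \<Rightarrow> (real \<times> real) set" where
  "lifted C = {z \<in> strip. annulus_cover z \<in> C}"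

lemma lifted_shift: "z + (real_of_int k, 0) \<in> lifted C \<longleftrightarrow> z \<in> lifted C"
  using annulus_cover_eq_iff[of "z + (real_of_int k, 0)" z] unfolding lifted_def by (auto simp: strip_iff)

text \<open>
  Running once along the lifted curve is a translation by a nonzero integer; if it is negative,
  run backwards.
\<close>

lemma lifted_travel:
  assumes C: "invariant_curve f C"
  shows "\<exists>k::nat>0. \<forall>z\<in>lifted C. path_component (lifted C) z (z + (real k, 0))"
proof -
  obtain \<gamma> where \<gamma>: "simple_path \<gamma>" "pathfinish \<gamma> = pathstart \<gamma>" "path_image \<gamma> = C" "C \<subseteq> annulus"
    "\<not> (\<exists>a. homotopic_loops annulus \<gamma> (linepath a a))"
    using C unfolding invariant_curve_def by blast
  have p: "path \<gamma>" using \<gamma>(1) by (rule simple_path_imp_path)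
  obtain h where h: "path h" "path_image h \<subseteq> strip" "\<And>t. t \<in> {0..1} \<Longrightarrow> annulus_cover (h t) = \<gamma> t"
    by (rule lift_annulus_path[OF p]) (use \<gamma> in auto)
  have "h 0 \<noteq> h 1" by (rule essential_lift_not_closed[OF h p]) (use \<gamma> in auto)
  moreover have "annulus_cover (h 1) = annulus_cover (h 0)"
    using h(3)[of 0] h(3)[of 1] \<gamma>(2) by (simp add: pathfinish_def pathstart_def)
  then obtain k where k: "h 1 = h 0 + (real_of_int k, 0)" unfolding annulus_cover_eq_iff by blast
  ultimately have k0: "k \<noteq> 0" by (metis add_Pair_zero of_int_0)
  have along: "path_component (lifted C) (h s + (real_of_int j, 0)) (h t + (real_of_int j, 0))"
    if "s \<in> {0..1}" "t \<in> {0..1}" for s t j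
  proof -
    let ?S = "(\<lambda>t. h t + (real_of_int j, 0)) ` {0..1}"
    have "path_connected ?S"
      using h(1) unfolding path_def by (intro path_connected_continuous_image continuous_intros) auto
    moreover have "?S \<subseteq> lifted C"
    proof
      fix w assume "w \<in> ?S"
      then obtain t where t: "t \<in> {0..1}" "w = h t + (real_of_int j, 0)" by blast
      have "h t \<in> lifted C"
        using t(1) h(2,3) \<gamma>(3) unfolding lifted_def path_image_def by auto
      then show "w \<in> lifted C" unfolding t(2) by (simp only: lifted_shift)
    qed
    ultimately show ?thesis using that
      by (meson image_eqI path_component_of_subset path_connected_component)
  qed
  have travel: "path_component (lifted C) z (z + (real_of_int k, 0))" if z: "z \<in> lifted C" for z
  proof -
    obtain t where t: "t \<in> {0..1}" "annulus_cover z = annulus_cover (h t)"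
      using z \<gamma>(3) h(3) unfolding lifted_def path_image_def by force
    then obtain j where j: "z = h t + (real_of_int j, 0)" unfolding annulus_cover_eq_iff by blast
    have "path_component (lifted C) z (h 1 + (real_of_int j, 0))"
      unfolding j by (rule along) (use t in auto)
    also have "h 1 + (real_of_int j, 0) = h 0 + (real_of_int (j + k), 0)"
      unfolding k by (simp add: prod_eq_iff)
    finally have "path_component (lifted C) z (h 0 + (real_of_int (j + k), 0))" .
    moreover have "path_component (lifted C) (h 0 + (real_of_int (j + k), 0)) (h t + (real_of_int (j + k), 0))"
      by (rule along) (use t in auto)
    moreover have "h t + (real_of_int (j + k), 0) = z + (real_of_int k, 0)"
      unfolding j by (simp add: prod_eq_iff)
    ultimately show ?thesis by (metis path_component_trans)
  qed
  show ?thesis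
  proof (cases "k > 0")
    case True
    then show ?thesis using travel by (intro exI[of _ "nat k"]) auto
  next
    case False
    have "path_component (lifted C) z (z + (real (nat (- k)), 0))" if "z \<in> lifted C" for z
    proof -
      have "z + (real_of_int (- k), 0) \<in> lifted C" using that lifted_shift by blast
      from travel[OF this] have "path_component (lifted C) (z + (real_of_int (- k), 0)) z"
        by (simp add: add.assoc)
      then show ?thesis using False by (simp add: path_component_sym)
    qed
    then show ?thesis using False k0 by (intro exI[of _ "nat (- k)"]) auto
  qed
qed

lemma birkhoff_lifted:
  assumes nw: "non_wandering f" and C: "invariant_curve f C"
  shows "birkhoff (extend F) (lifted C)"
proof -
  interpret T: nonwandering_twist "extend F" by (rule nonwandering_twist_extend[OF nw])
  obtain \<gamma> where \<gamma>: "simple_path \<gamma>" "path_image \<gamma> = C" and CA: "C \<subseteq> annulus" and fC: "f ` C = C"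
    using C unfolding invariant_curve_def by blast
  show ?thesis
  proof
    have "closed (annulus_cover -` C)"
      using \<gamma> by (intro closed_vimage continuous_annulus_cover)
        (metis closed_path_image simple_path_imp_path)
    moreover have "closed strip" unfolding strip_def by (intro closed_Times) auto
    moreover have "lifted C = strip \<inter> annulus_cover -` C" unfolding lifted_def by blast
    ultimately show "closed (lifted C)" by auto
    show "lifted C \<subseteq> strip" unfolding lifted_def by blast
    obtain p where "p \<in> C" using \<gamma>(2) path_image_nonempty by blast
    then show "lifted C \<noteq> {}" using annulus_cover_surj CA unfolding lifted_def by (metis (mono_tags, lifting) empty_iff mem_Collect_eq subsetD)
    show "extend F z \<in> lifted C \<longleftrightarrow> z \<in> lifted C" for z
    proof (cases "z \<in> strip")
      case True
      have "f (annulus_cover z) \<in> C \<longleftrightarrow> annulus_cover z \<in> C"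
      proof
        assume "f (annulus_cover z) \<in> C"
        then obtain p where "p \<in> C" "f (annulus_cover z) = f p" using fC by (metis imageE)
        then show "annulus_cover z \<in> C" using f_inj annulus_cover_in_annulus[OF True] CA by blast
      qed (use fC in blast)
      then show ?thesis using True F_strip F_cover unfolding lifted_def by simp
    next
      case False
      then have "extend F z \<notin> strip" using extend_snd(1,2)[of z] by (auto simp: strip_iff)
      then show ?thesis using False unfolding lifted_def by simp
    qed
    show "z + (1, 0) \<in> lifted C \<longleftrightarrow> z \<in> lifted C" for z using lifted_shift[of z 1] by simp
    show "\<exists>k::nat>0. \<forall>z\<in>lifted C. path_component (lifted C) z (z + (real k, 0))"
      by (rule lifted_travel[OF C])
  qed
qed

text \<open>
  Birkhoff's theorem. The lower envelope of the lifted curve is an invariant graph; it projects to a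
  simple closed curve contained in \<open>C\<close>, which must be all of \<open>C\<close>.
\<close>

lemma invariant_curve_is_graph:
  assumes nw: "non_wandering f" and C: "invariant_curve f C"
  obtains \<phi> where "invariant_graph (extend F) \<phi>" "lifted C = {z. snd z = \<phi> (fst z)}"
proof -
  interpret B: birkhoff "extend F" "lifted C" by (rule birkhoff_lifted[OF nw C])
  obtain \<gamma> where \<gamma>: "simple_path \<gamma>" "pathfinish \<gamma> = pathstart \<gamma>" "path_image \<gamma> = C"
    using C unfolding invariant_curve_def by blast
  define \<eta> where "\<eta> t = annulus_cover (t, B.height t)" for t
  have "path \<eta>" unfolding path_def \<eta>_def
    by (rule continuous_on_compose2[OF continuous_annulus_cover[of UNIV]])
       (auto intro!: continuous_intros B.continuous_height)
  moreover have "s = t \<or> s = 0 \<and> t = 1 \<or> s = 1 \<and> t = 0" if st: "s \<in> {0..1}" "t \<in> {0..1}" "\<eta> s = \<eta> t" for s t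
  proof -
    obtain k where "(s, B.height s) = (t, B.height t) + (real_of_int k, 0)"
      using st(3) unfolding \<eta>_def annulus_cover_eq_iff by blast
    then have k: "s = t + real_of_int k" by simp
    then have "\<bar>real_of_int k\<bar> \<le> 1" using st(1,2) by auto
    then have "k = 0 \<or> k = 1 \<or> k = -1" by linarith
    then show ?thesis using k st(1,2) by auto
  qed
  ultimately have simple: "simple_path \<eta>" unfolding simple_path_def loop_free_def by blast
  have "(1, B.height 1) = (0, B.height 0) + (real_of_int 1, 0)" using B.height_shift[of 0] by simp
  then have closed: "pathfinish \<eta> = pathstart \<eta>"
    unfolding pathfinish_def pathstart_def \<eta>_def annulus_cover_eq_iff by blast
  have sub: "path_image \<eta> \<subseteq> path_image \<gamma>"
    using B.height_in_K \<gamma>(3) unfolding path_image_def \<eta>_def lifted_def by auto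
  have eq: "path_image \<eta> = C"
    using simple_closed_path_image_eq[OF \<gamma>(1,2) simple closed sub] \<gamma>(3) by simp
  have height_int: "B.height (x + real_of_int k) = B.height x" for x k
    using periodic_int[of B.height x k] B.height_shift by simp
  have graph: "z \<in> lifted C \<longleftrightarrow> snd z = B.height (fst z)" for z
  proof
    assume "z \<in> lifted C"
    then have "annulus_cover z \<in> path_image \<eta>" unfolding eq lifted_def by blast
    then obtain t where "annulus_cover z = annulus_cover (t, B.height t)"
      unfolding path_image_def \<eta>_def by blast
    then obtain k where "z = (t, B.height t) + (real_of_int k, 0)" unfolding annulus_cover_eq_iff by blast
    then show "snd z = B.height (fst z)" using height_int by simp
  next
    assume "snd z = B.height (fst z)"
    then show "z \<in> lifted C" using B.height_in_K[of "fst z"] by (metis prod.collapse)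
  qed
  have "invariant_graph (extend F) B.height"
  proof
    show "snd (extend F z) < B.height (fst (extend F z)) \<longleftrightarrow> snd z < B.height (fst z)" for z
      using B.below_invariant[of z] unfolding B.below_iff .
  qed (use B.continuous_height B.height_shift B.height_bounds B.graph_invariant in auto)
  then show ?thesis by (rule that) (use graph in blast)
qed

lemma rotation_number_graph:
  assumes \<phi>: "invariant_graph (extend F) \<phi>" and graph: "lifted C = {z. snd z = \<phi> (fst z)}"
  shows "rotation_number F C = circle_lift.rotation (invariant_graph.g (extend F) \<phi>)"
proof -
  interpret G: invariant_graph "extend F" \<phi> by fact
  have lim: "(\<lambda>n. (fst ((F ^^ n) z) - fst z) / real n) \<longlonglongrightarrow> G.circle.rotation"
    if "z \<in> strip" "annulus_cover z \<in> C" for z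
  proof -
    have "z \<in> lifted C" using that unfolding lifted_def by blast
    then have z: "z = (fst z, \<phi> (fst z))" unfolding graph by (simp add: prod_eq_iff)
    have "(\<lambda>n. (fst ((extend F ^^ n) (fst z, \<phi> (fst z))) - fst z) / real n) \<longlonglongrightarrow> G.circle.rotation"
      by (rule G.rotation_on_graph)
    then show ?thesis using iter_lift(3)[OF that(1)] z by simp
  qed
  show ?thesis unfolding rotation_number_def
  proof (rule the_equality)
    show "has_rotation_number F C G.circle.rotation" unfolding has_rotation_number_def using lim by blast
    fix \<rho> assume \<rho>: "has_rotation_number F C \<rho>"
    have "(0, \<phi> 0) \<in> lifted C" using graph by simp
    then have z: "(0, \<phi> 0) \<in> strip" "annulus_cover (0, \<phi> 0) \<in> C" unfolding lifted_def by blast+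
    show "\<rho> = G.circle.rotation"
      using LIMSEQ_unique[OF _ lim[OF z]] \<rho> z unfolding has_rotation_number_def by blast
  qed
qed

end

theorem corollary1p2:
  fixes f :: "complex \<times> real \<Rightarrow> complex \<times> real"
    and F :: "real \<times> real \<Rightarrow> real \<times> real"
    and C1 C2 :: "(complex \<times> real) set"
  assumes "twist_map f"
    and "non_wandering f"
    and "invariant_curve f C1"
    and "invariant_curve f C2"
    and "C1 \<inter> C2 = {}"
    and "is_lift F f"
  shows "rotation_number F C1 \<noteq> rotation_number F C2"
proof -
  interpret annulus_twist f F using assms(1,6) by unfold_locales
  obtain \<phi> where \<phi>: "invariant_graph (extend F) \<phi>" "lifted C1 = {z. snd z = \<phi> (fst z)}"
    by (rule invariant_curve_is_graph[OF assms(2,3)])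
  obtain \<psi> where \<psi>: "invariant_graph (extend F) \<psi>" "lifted C2 = {z. snd z = \<psi> (fst z)}"
    by (rule invariant_curve_is_graph[OF assms(2,4)])
  interpret P: invariant_graph "extend F" \<phi> by (rule \<phi>(1))
  interpret Q: invariant_graph "extend F" \<psi> by (rule \<psi>(1))
  have "\<psi> x - \<phi> x \<noteq> 0" for x
  proof
    assume "\<psi> x - \<phi> x = 0"
    then have "(x, \<phi> x) \<in> lifted C1 \<inter> lifted C2" using \<phi>(2) \<psi>(2) by simp
    then show False using assms(5) unfolding lifted_def by blast
  qed
  moreover have "continuous_on UNIV (\<lambda>x. \<psi> x - \<phi> x)" by (intro continuous_intros P.\<phi>_cont Q.\<phi>_cont)
  ultimately consider "\<forall>x. \<phi> x < \<psi> x" | "\<forall>x. \<psi> x < \<phi> x"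
    using nonzero_constant_sign[of "\<lambda>x. \<psi> x - \<phi> x"] by auto
  then have "P.circle.rotation \<noteq> Q.circle.rotation"
  proof cases
    case 1
    then interpret ordered_graphs "extend F" \<phi> \<psi> by unfold_locales auto
    show ?thesis by (rule rotation_different)
  next
    case 2
    then interpret ordered_graphs "extend F" \<psi> \<phi> by unfold_locales auto
    show ?thesis using rotation_different by simp
  qed
  then show ?thesis
    using rotation_number_graph[OF \<phi>] rotation_number_graph[OF \<psi>] by simp
qed

end
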